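(* Let $n\ge0$, $\lambda>0$ and $0<\alpha<n+1$. Let $K_{\lambda,\alpha}$ be the kernel of the fractional Bessel operator $(-\Delta_\lambda)^{-\alpha/2}$ on $\mathbb R^{n+1}_+$, and $V_\lambda(x,y)=m_\lambda(B(x,|x-y|)\cap\mathbb R^{n+1}_+)$. Then for all $x,y\in\mathbb R^{n+1}_+$ with $x\ne y$, $$K_{\lambda,\alpha}(x,y)\sim\frac{|x-y|^\alpha}{V_\lambda(x,y)},$$ and for all $x,x',y\in\mathbb R^{n+1}_+$ with $|x-x'|<|x-y|/2$, $$|K_{\lambda,\alpha}(x,y)-K_{\lambda,\alpha}(x',y)|+|K_{\lambda,\alpha}(y,x)-K_{\lambda,\alpha}(y,x')|\lesssim\frac{|x-y|^\alpha}{V_\lambda(x,y)}\cdot\frac{|x-x'|}{|x-y|}.$$ In particular, $(-\Delta_\lambda)^{-\alpha/2}$ is a strongly non-degenerate $\phi$-fractional integral operator on $(\mathbb R^{n+1}_+,|x-y|,m_\lambda)$ with $\phi(x,y)=|x-y|^\alpha$, and its kernel $K_{\lambda,\alpha}$ is $\omega$-regular with $\omega(t)=t$ and non-degenerate.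
   Context: $\mathbb R^{n+1}_+=\mathbb R^n\times(0,\infty)$ (for $n=0$, $(0,\infty)$), points $x=(x',x_{n+1})$ (in the claim, $x'$ denotes another point of $\mathbb R^{n+1}_+$), Euclidean metric, measure $dm_\lambda(x)=x_{n+1}^{2\lambda}dx$. $\Delta_\lambda=\sum_{j=1}^{n+1}\partial_{x_j}^2+\frac{2\lambda}{x_{n+1}}\partial_{x_{n+1}}$. For $x=(\bar x,x_{n+1})$, $y=(\bar y,y_{n+1})$, $t>0$, the heat kernel of the semigroup generated by $\Delta_\lambda$ with respect to $m_\lambda$ is $$p_t(x,y)=\frac{e^{-|\bar x-\bar y|^2/(4t)}}{(4\pi t)^{n/2}}\cdot\frac{(x_{n+1}y_{n+1})^{-\lambda+\frac12}}{2t}e^{-\frac{x_{n+1}^2+y_{n+1}^2}{4t}}I_{\lambda-\frac12}\Big(\frac{x_{n+1}y_{n+1}}{2t}\Big)$$ (first factor $=1$ if $n=0$), with $I_\nu$ the modified Bessel function of the first kind, and $K_{\lambda,\alpha}(x,y)=\frac{1}{\Gamma(\alpha/2)}\int_0^\infty p_t(x,y)\frac{dt}{t^{1-\alpha/2}}$ for $x\ne y$; $(-\Delta_\lambda)^{-\alpha/2}f(x)=\int K_{\lambda,\alpha}(x,y)f(y)dm_\lambda(y)$. $\sim$ and $\lesssim$ hide positive constants depending only on $n,\lambda,\alpha$. Below, balls are $B(x,r)=\{y\in\mathbb R^{n+1}_+:|x-y|<r\}$, $V(x,r)=m_\lambda(B(x,r))$, $\phi(x,r)=r^\alpha$, $K=K_{\lambda,\alpha}$.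 $\phi$-fractional integral operator: $K$ is locally integrable on the product and $|K(x,y)|\le C_K|x-y|^\alpha/V_\lambda(x,y)$ for $x\ne y$. Strongly non-degenerate: there are constants $A,c_1,\overline C>0$ and $\eta\in[0,\frac\pi9]$ such that for every $x_0$ and $r>0$ there are $y_0\in B(x_0,\overline CAr)\setminus B(x_0,Ar)$ and $v\in\mathbb C$, $|v|=1$, such that at least one of the following holds: (a) $|K(x,y)|\ge c_1\phi(x_0,r)/V(x_0,r)$ and $|\arg(\bar vK(x,y))|\le\eta$ for all $x\in B(x_0,r)$, $y\in B(y_0,r)$; (b) the same with $K(y,x)$ in place of $K(x,y)$. $\omega$-regular: $|K(x,y)-K(x',y)|+|K(y,x)-K(y,x')|\le C\,\omega\big(\frac{|x-x'|}{|x-y|}\big)\frac{|x-y|^\alpha}{V_\lambda(x,y)}$ for $|x-x'|<\frac12|x-y|$ (with a multiplicative constant $C$ allowed). Non-degenerate: there are $c_0,\overline C>0$ such that for every $x$ and $r>0$ there is $y\in B(x,\overline Cr)\setminus B(x,r)$ with $|K(x,y)|+|K(y,x)|\ge c_0|x-y|^\alpha/V_\lambda(x,y)$. *)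

theory Defs
  imports "HOL-Analysis.Analysis"
begin

text \<open>
  Metric measure spaces are given by a measure \<open>\<mu>\<close> on a metric type; the space itself is the
  carrier \<open>space \<mu>\<close>, so balls are taken relative to that carrier.
\<close>

definition rel_ball :: "'a::metric_space measure \<Rightarrow> 'a \<Rightarrow> real \<Rightarrow> 'a set" where
  "rel_ball \<mu> x r = {y \<in> space \<mu>. dist x y < r}"

definition ball_vol :: "'a::metric_space measure \<Rightarrow> 'a \<Rightarrow> real \<Rightarrow> real" where
  "ball_vol \<mu> x r = measure \<mu> (rel_ball \<mu> x r)"

text \<open>
  The function \<open>\<phi>\<close> takes a point and a radius. Local integrability on the product is
  integrability over products of balls; such sets may touch the boundary of the space, so this
  implies integrability over compact subsets of the product.
\<close>

definition locally_integrable_kernel ::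
    "'a::metric_space measure \<Rightarrow> ('a \<Rightarrow> 'a \<Rightarrow> complex) \<Rightarrow> bool" where
  "locally_integrable_kernel \<mu> K \<longleftrightarrow>
     (\<forall>x\<in>space \<mu>. \<forall>y\<in>space \<mu>. \<forall>r>0.
        set_integrable (\<mu> \<Otimes>\<^sub>M \<mu>) (rel_ball \<mu> x r \<times> rel_ball \<mu> y r) (\<lambda>(u, w). K u w))"

definition fractional_integral_operator ::
    "'a::metric_space measure \<Rightarrow> ('a \<Rightarrow> real \<Rightarrow> real) \<Rightarrow>
     (('a \<Rightarrow> complex) \<Rightarrow> 'a \<Rightarrow> complex) \<Rightarrow> ('a \<Rightarrow> 'a \<Rightarrow> complex) \<Rightarrow> bool" where
  "fractional_integral_operator \<mu> \<phi> T K \<longleftrightarrow>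
     (\<forall>f. \<forall>x\<in>space \<mu>. T f x = (LINT y|\<mu>. K x y * f y)) \<and>
     locally_integrable_kernel \<mu> K \<and>
     (\<exists>C>0. \<forall>x\<in>space \<mu>. \<forall>y\<in>space \<mu>. x \<noteq> y \<longrightarrow>
        norm (K x y) \<le> C * \<phi> x (dist x y) / ball_vol \<mu> x (dist x y))"

definition strongly_nondegenerate ::
    "'a::metric_space measure \<Rightarrow> ('a \<Rightarrow> real \<Rightarrow> real) \<Rightarrow> ('a \<Rightarrow> 'a \<Rightarrow> complex) \<Rightarrow> bool" where
  "strongly_nondegenerate \<mu> \<phi> K \<longleftrightarrow>
     (\<exists>A>0. \<exists>c1>0. \<exists>C>0. \<exists>\<eta>\<in>{0..pi/9}.
        \<forall>x0\<in>space \<mu>. \<forall>r>0.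
          \<exists>y0\<in>rel_ball \<mu> x0 (C * A * r) - rel_ball \<mu> x0 (A * r). \<exists>v. norm v = 1 \<and>
            ((\<forall>x\<in>rel_ball \<mu> x0 r. \<forall>y\<in>rel_ball \<mu> y0 r.
                norm (K x y) \<ge> c1 * \<phi> x0 r / ball_vol \<mu> x0 r \<and> \<bar>Arg (cnj v * K x y)\<bar> \<le> \<eta>) \<or>
             (\<forall>x\<in>rel_ball \<mu> x0 r. \<forall>y\<in>rel_ball \<mu> y0 r.
                norm (K y x) \<ge> c1 * \<phi> x0 r / ball_vol \<mu> x0 r \<and> \<bar>Arg (cnj v * K y x)\<bar> \<le> \<eta>)))"

definition omega_regular ::
    "'a::metric_space measure \<Rightarrow> ('a \<Rightarrow> real \<Rightarrow> real) \<Rightarrow> (real \<Rightarrow> real) \<Rightarrow>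
     ('a \<Rightarrow> 'a \<Rightarrow> complex) \<Rightarrow> bool" where
  "omega_regular \<mu> \<phi> \<omega> K \<longleftrightarrow>
     (\<exists>C>0. \<forall>x\<in>space \<mu>. \<forall>x'\<in>space \<mu>. \<forall>y\<in>space \<mu>. dist x x' < dist x y / 2 \<longrightarrow>
        norm (K x y - K x' y) + norm (K y x - K y x')
          \<le> C * \<omega> (dist x x' / dist x y) * (\<phi> x (dist x y) / ball_vol \<mu> x (dist x y)))"

definition nondegenerate ::
    "'a::metric_space measure \<Rightarrow> ('a \<Rightarrow> real \<Rightarrow> real) \<Rightarrow> ('a \<Rightarrow> 'a \<Rightarrow> complex) \<Rightarrow> bool" where
  "nondegenerate \<mu> \<phi> K \<longleftrightarrow>
     (\<exists>c0>0. \<exists>C>0. \<forall>x\<in>space \<mu>. \<forall>r>0.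
        \<exists>y\<in>rel_ball \<mu> x (C * r) - rel_ball \<mu> x r.
          norm (K x y) + norm (K y x) \<ge> c0 * \<phi> x (dist x y) / ball_vol \<mu> x (dist x y))"

text \<open>
  \<open>\<real>\<^sup>n\<^sup>+\<^sup>1\<close> is \<open>real ^ 'm\<close> with \<open>CARD('m) = n + 1\<close>, so \<open>n = 0\<close> is included. The index type is
  ordered and \<open>x\<^sub>n\<^sub>+\<^sub>1\<close> is the component of largest index.
\<close>

definition last_coord :: "real ^ 'm::{finite,linorder} \<Rightarrow> real" where
  "last_coord x = x $ Max UNIV"

definition upper_half_space :: "(real ^ 'm::{finite,linorder}) set" where
  "upper_half_space = {x. last_coord x > 0}"

definition bessel_measure :: "real \<Rightarrow> (real ^ 'm::{finite,linorder}) measure" where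
  "bessel_measure lam =
     density (restrict_space lborel upper_half_space) (\<lambda>x. ennreal (last_coord x powr (2 * lam)))"

text \<open>
  Modified Bessel function of the first kind of real order, for positive arguments. The reciprocal
  Gamma function \<open>rGamma\<close> vanishes at the poles of \<open>Gamma\<close>, so the series is the right one for every
  order.
\<close>

definition bessel_I :: "real \<Rightarrow> real \<Rightarrow> real" where
  "bessel_I \<nu> z = (\<Sum>k. (z / 2) powr (2 * real k + \<nu>) * rGamma (real k + \<nu> + 1) / fact k)"

text \<open>
  The Gaussian factor in the first \<open>n = CARD('m) - 1\<close> variables is \<open>1\<close> when \<open>n = 0\<close>: the sum is then
  empty and the exponent of \<open>4 * pi * t\<close> is \<open>0\<close>.
\<close>

definition bessel_heat_kernel ::
    "real \<Rightarrow> real \<Rightarrow> real ^ 'm::{finite,linorder} \<Rightarrow> real ^ 'm::{finite,linorder} \<Rightarrow> real" where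
  "bessel_heat_kernel lam t x y =
     exp (- (\<Sum>i\<in>UNIV - {Max UNIV}. (x $ i - y $ i)\<^sup>2) / (4 * t))
       / (4 * pi * t) powr (real (CARD('m) - 1) / 2)
     * ((last_coord x * last_coord y) powr (- lam + 1 / 2) / (2 * t))
     * exp (- ((last_coord x)\<^sup>2 + (last_coord y)\<^sup>2) / (4 * t))
     * bessel_I (lam - 1 / 2) (last_coord x * last_coord y / (2 * t))"

definition frac_bessel_kernel ::
    "real \<Rightarrow> real \<Rightarrow> real ^ 'm::{finite,linorder} \<Rightarrow> real ^ 'm::{finite,linorder} \<Rightarrow> real" where
  "frac_bessel_kernel lam \<alpha> x y =
     1 / Gamma (\<alpha> / 2) * (LINT t:{0<..}|lborel. bessel_heat_kernel lam t x y / t powr (1 - \<alpha> / 2))"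

definition frac_bessel_operator ::
    "real \<Rightarrow> real \<Rightarrow> (real ^ 'm::{finite,linorder} \<Rightarrow> complex) \<Rightarrow> real ^ 'm::{finite,linorder} \<Rightarrow> complex" where
  "frac_bessel_operator lam \<alpha> f x =
     (LINT y|bessel_measure lam. complex_of_real (frac_bessel_kernel lam \<alpha> x y) * f y)"

end

theory Submission
  imports Defs
begin

text \<open>
  Let \<open>N = n + 1\<close>, \<open>\<beta> = N/2 + \<lambda> - \<alpha>/2 > \<lambda>\<close>, \<open>D = |x - y|\<close>, and let \<open>a\<close>, \<open>c\<close> be the last coordinates of
  \<open>x\<close>, \<open>y\<close>. Inserting Poisson's integral for \<open>I\<^sub>\<lambda>\<^sub>-\<^sub>1\<^sub>/\<^sub>2\<close> into the heat kernel and integrating in \<open>t\<close> first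
  turns \<open>K(x, y)\<close> into a constant multiple of the integral of \<open>(1 - s\<^sup>2)\<^sup>\<lambda>\<^sup>-\<^sup>1 Q\<^sub>s(x, y)\<^sup>-\<^sup>\<beta>\<close> over
  \<open>-1 < s < 1\<close>, where \<open>Q\<^sub>s(x, y) = D\<^sup>2 + 2 a c (1 - s)\<close>.

  Splitting at \<open>1 - s \<approx> D\<^sup>2/(D\<^sup>2 + a c)\<close> gives \<open>K \<sim> D\<^sup>\<alpha>\<^sup>-\<^sup>N (a + D)\<^sup>-\<^sup>2\<^sup>\<lambda>\<close>, and a ball of radius \<open>r\<close> about \<open>x\<close>
  has measure comparable to \<open>r\<^sup>N (a + r)\<^sup>2\<^sup>\<lambda>\<close>.

  For the regularity, \<open>\<surd>Q\<^sub>s\<close> is a Euclidean distance from \<open>x\<close> to a point of one more dimension. It is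
  therefore 1-Lipschitz in \<open>x\<close> and at least \<open>D\<close>, so the integrand changes by a factor
  \<open>1 + O(|x - x'|/D)\<close> between \<open>x\<close> and \<open>x'\<close>, and so does the integral.
\<close>

subsection \<open>Power integrals on the half-line\<close>

text \<open>Integrating in \<open>t\<close> first avoids asymptotics and derivatives of the Bessel
  function: every bound compares nonnegative integrands that depend on x and y through powers of Q.
  The one-variable integrals behind the constants depend on x and y only by scaling, which makes the
  constants uniform. The assumption \<alpha> < n + 1 acts in two ways. As \<beta> > \<lambda> it
  gives convergence at infinity once the v-interval is extended to the half-line; as \<alpha> - N <
  0 it makes the size function D^(\<alpha>-N) (a + D)^(-2\<lambda>) decreasing in D. The factor (a +
  D)^(-2\<lambda>) matches the volume, absorbs the density of the measure in the proof of local
  integrability, and passes by monotonicity to pairs of balls in strong non-degeneracy. There the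
  kernel is a positive real, so no rotation and no opening angle are required. The regularity bound
  is relative, with K(x, y) itself on the right, so it calls for no second size estimate.\<close>

lemma nn_integral_powr_Ioo:
  fixes a c :: real
  assumes "0 < a" "0 \<le> c"
  shows "(\<integral>\<^sup>+v. ennreal (v powr (a - 1)) * indicator {0<..<c} v \<partial>lborel) = ennreal (c powr a / a)"
proof -
  have "((\<lambda>v. v powr (a - 1)) has_integral (c powr a / a)) {0<..<c}"
    using has_integral_powr_from_0[of "a - 1" c] assms by (simp add: has_integral_Icc_iff_Ioo)
  then show ?thesis
    by (intro nn_integral_has_integral_lebesgue') auto
qed

lemma nn_integral_powr_atLeast_1:
  fixes a :: real
  assumes "0 < a"
  shows "(\<integral>\<^sup>+v. ennreal (v powr (- a - 1)) * indicator {1..} v \<partial>lborel) = ennreal (1 / a)"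
proof -
  have "(\<integral>\<^sup>+v. ennreal (v powr (- a - 1)) * indicator {1..} v \<partial>lborel) = 0 - (- (1 powr (-a) / a))"
  proof (rule nn_integral_FTC_atLeast)
    fix x :: real assume "1 \<le> x"
    then show "((\<lambda>x. - (x powr (-a) / a)) has_real_derivative x powr (- a - 1)) (at x)"
      using assms by (auto intro!: derivative_eq_intros)
  next
    show "((\<lambda>x. - (x powr (-a) / a)) \<longlongrightarrow> 0) at_top"
      using tendsto_minus[OF tendsto_divide[OF tendsto_neg_powr[OF _ filterlim_ident] tendsto_const], of "- a" a]
        assms by simp
  qed auto
  then show ?thesis by simp
qed

text \<open>Convergence at 0 comes from \<open>0 < a\<close>, at infinity from \<open>a < b\<close>.
  The case a = \<lambda>, b = \<beta> serves the upper bound of the kernel; a = 1 gives the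
  comparison function for the \<open>t\<close>-integral.\<close>

lemma nn_integral_powr_shift_finite:
  fixes a b :: real
  assumes "0 < a" "a < b"
  shows "(\<integral>\<^sup>+v. ennreal (v powr (a - 1) * (1 + v) powr (- b)) * indicator {0<..} v \<partial>lborel) < \<infinity>"
proof -
  have "(\<integral>\<^sup>+v. ennreal (v powr (a - 1) * (1 + v) powr (- b)) * indicator {0<..} v \<partial>lborel)
     \<le> (\<integral>\<^sup>+v. ennreal (v powr (a - 1)) * indicator {0<..<1} v
            + ennreal (v powr (- (b - a) - 1)) * indicator {1..} v \<partial>lborel)"
  proof (rule nn_integral_mono)
    fix v :: real
    have 1: "v powr (a - 1) * (1 + v) powr (- b) \<le> v powr (a - 1)" if "0 < v"
    proof -
      have "(1 + v) powr (- b) \<le> 1 powr (- b)" using that assms by (intro powr_mono2') auto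
      then show ?thesis by (simp add: mult_left_le)
    qed
    have 2: "v powr (a - 1) * (1 + v) powr (- b) \<le> v powr (- (b - a) - 1)" if "1 \<le> v"
    proof -
      have "v powr (a - 1) * (1 + v) powr (- b) \<le> v powr (a - 1) * v powr (- b)"
        using that assms by (intro mult_left_mono powr_mono2') auto
      also have "\<dots> = v powr (- (b - a) - 1)"
        by (simp add: powr_add[symmetric] algebra_simps)
      finally show ?thesis .
    qed
    show "ennreal (v powr (a - 1) * (1 + v) powr (- b)) * indicator {0<..} v
       \<le> ennreal (v powr (a - 1)) * indicator {0<..<1} v
            + ennreal (v powr (- (b - a) - 1)) * indicator {1..} v"
      using 1 2 by (auto simp: indicator_def ennreal_leI)
  qed
  also have "\<dots> = ennreal (1 / a) + ennreal (1 / (b - a))"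
    using assms nn_integral_powr_Ioo[of a 1] nn_integral_powr_atLeast_1[of "b - a"]
    by (subst nn_integral_add) auto
  also have "\<dots> < \<infinity>" by simp
  finally show ?thesis .
qed

text \<open>Substituting v = (E/P) u extracts both powers. \<open>M\<close> is the Beta value B(a, b
  - a); what matters is that it is the same for all \<open>E\<close> and \<open>P\<close>.\<close>

lemma nn_integral_powr_shift_scale:
  fixes a b :: real
  assumes "0 < a" "a < b"
  shows "\<exists>M\<ge>0. \<forall>E>0. \<forall>P>0.
    (\<integral>\<^sup>+v. ennreal (v powr (a - 1) * (E + P * v) powr (- b)) * indicator {0<..} v \<partial>lborel)
      = ennreal (M * E powr (a - b) * P powr (- a))"
proof -
  define F where "F = (\<integral>\<^sup>+v. ennreal (v powr (a - 1) * (1 + v) powr (- b)) * indicator {0<..} v \<partial>lborel)"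
  have F: "F = ennreal (enn2real F)"
    using nn_integral_powr_shift_finite[OF assms] by (simp add: F_def less_top[symmetric])
  have "(\<integral>\<^sup>+v. ennreal (v powr (a - 1) * (E + P * v) powr (- b)) * indicator {0<..} v \<partial>lborel)
      = ennreal (enn2real F * E powr (a - b) * P powr (- a))" if EP: "E > 0" "P > 0" for E P :: real
  proof -
    have "(\<integral>\<^sup>+v. ennreal (v powr (a - 1) * (E + P * v) powr (- b)) * indicator {0<..} v \<partial>lborel)
      = \<bar>E / P\<bar> * (\<integral>\<^sup>+v. ennreal ((0 + E / P * v) powr (a - 1) * (E + P * (0 + E / P * v)) powr (- b))
            * indicator {0<..} (0 + E / P * v) \<partial>lborel)"
      using EP by (intro nn_integral_real_affine) auto
    also have "\<dots> = ennreal (E / P) * (\<integral>\<^sup>+v. ennreal ((E / P) powr (a - 1) * E powr (- b))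
        * (ennreal (v powr (a - 1) * (1 + v) powr (- b)) * indicator {0<..} v) \<partial>lborel)"
    proof -
      have *: "ennreal ((0 + E / P * v) powr (a - 1) * (E + P * (0 + E / P * v)) powr (- b))
            * indicator {0<..} (0 + E / P * v) = ennreal ((E / P) powr (a - 1) * E powr (- b))
        * (ennreal (v powr (a - 1) * (1 + v) powr (- b)) * indicator {0<..} v)" for v
      proof (cases "v > 0")
        case True
        have "E + P * (0 + E / P * v) = E * (1 + v)" using EP by (simp add: field_simps)
        moreover have "(0 + E / P * v) powr (a - 1) = (E / P) powr (a - 1) * v powr (a - 1)"
          using EP True by (simp add: powr_mult[symmetric])
        moreover have "(E * (1 + v)) powr (- b) = E powr (- b) * (1 + v) powr (- b)"
          using EP True by (simp add: powr_mult)
        ultimately show ?thesis using EP True by (simp add: ennreal_mult'[symmetric] mult_ac)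
      next
        case False
        then have "\<not> 0 + E / P * v > 0" using EP by (simp add: zero_less_mult_iff zero_less_divide_iff not_less)
        with False show ?thesis by (simp add: indicator_def)
      qed
      show ?thesis using EP unfolding * by simp
    qed
    also have "\<dots> = ennreal (E / P) * (ennreal ((E / P) powr (a - 1) * E powr (- b)) * F)"
      unfolding F_def by (subst nn_integral_cmult) auto
    also have "\<dots> = ennreal (E / P * ((E / P) powr (a - 1) * E powr (- b) * enn2real F))"
      using EP by (subst F) (simp add: ennreal_mult[symmetric])
    also have "E / P * ((E / P) powr (a - 1) * E powr (- b) * enn2real F)
        = enn2real F * E powr (a - b) * P powr (- a)"
      using EP by (simp add: powr_divide powr_diff powr_minus field_simps)
    finally show ?thesis .
  qed
  then show ?thesis by (intro exI[of _ "enn2real F"]) auto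
qed

text \<open>From u \<le> e^u with u = (1 + x)/(4 b). The 4 is chosen so that x = 1/t leaves exp(1/(4
  t)), which cancels the exponential in the integral below.\<close>

lemma one_plus_powr_le_exp:
  fixes b x :: real
  assumes "0 < b" "0 \<le> x"
  shows "(1 + x) powr b \<le> (4 * b) powr b * exp (1 / 4) * exp (x / 4)"
proof -
  have "(1 + x) = 4 * b * ((1 + x) / (4 * b))" using assms by simp
  also have "\<dots> \<le> 4 * b * exp ((1 + x) / (4 * b))"
    using assms exp_ge_add_one_self[of "(1 + x) / (4 * b)"] by (intro mult_left_mono) linarith+
  finally have "(1 + x) powr b \<le> (4 * b * exp ((1 + x) / (4 * b))) powr b"
    using assms by (intro powr_mono2) auto
  also have "\<dots> = (4 * b) powr b * exp ((1 + x) / 4)"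
    using assms by (simp add: powr_mult exp_powr_real)
  also have "exp ((1 + x) / 4) = exp (1 / 4) * exp (x / 4)"
    by (simp add: exp_add add_divide_distrib)
  finally show ?thesis by (simp add: mult.assoc)
qed

text \<open>Substituting t = Q u extracts the power of \<open>Q\<close>; the constant is 4^b times
  Gamma(b). It has to be positive as well as finite, because it also multiplies the lower bound of
  the kernel.\<close>

lemma nn_integral_powr_exp_inverse_scale:
  fixes b :: real
  assumes "0 < b"
  shows "\<exists>c>0. \<forall>Q>0.
    (\<integral>\<^sup>+t. ennreal (t powr (- b - 1) * exp (- Q / (4 * t))) * indicator {0<..} t \<partial>lborel)
      = ennreal (c * Q powr (- b))"
proof -
  define f where "f = (\<lambda>Q t::real. ennreal (t powr (- b - 1) * exp (- Q / (4 * t))) * indicator {0<..} t)"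
  have [measurable]: "f Q \<in> borel_measurable borel" for Q unfolding f_def by measurable
  define F where "F = (\<integral>\<^sup>+t. f 1 t \<partial>lborel)"
  \<comment> \<open>The constant of \<open>one_plus_powr_le_exp\<close> for the exponent b +
    1.\<close>
  define k where "k = (4 * (b + 1)) powr (b + 1) * exp (1 / 4)"
  have "F \<le> (\<integral>\<^sup>+t. ennreal k * (ennreal (t powr (1 - 1) * (1 + t) powr (- (b + 1))) * indicator {0<..} t) \<partial>lborel)"
    unfolding F_def
  proof (rule nn_integral_mono)
    fix t :: real
    \<comment> \<open>Since (1 + t)/t = 1 + 1/t, the exponential absorbs the blow-up at 0 and an
      integrable power of 1 + t remains.\<close>
    have "t powr (- b - 1) * exp (- 1 / (4 * t)) \<le> k * (1 + t) powr (- (b + 1))" if t: "t > 0"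
    proof -
      have "t powr (- b - 1) * (1 + t) powr (b + 1) = (1 + 1 / t) powr (b + 1)"
      proof -
        have "1 + 1 / t = (1 + t) / t" using t by (simp add: field_simps)
        then have "(1 + 1 / t) powr (b + 1) = (1 + t) powr (b + 1) / t powr (b + 1)"
          using t by (simp add: powr_divide)
        moreover have "t powr (- b - 1) = 1 / t powr (b + 1)"
          using powr_minus_divide[of t "b + 1"] by simp
        ultimately show ?thesis by simp
      qed
      also have "\<dots> \<le> k * exp (1 / (4 * t))"
        using one_plus_powr_le_exp[of "b + 1" "1 / t"] t assms by (simp add: k_def mult.commute)
      finally have 1: "t powr (- b - 1) * (1 + t) powr (b + 1) \<le> k * exp (1 / (4 * t))" .
      have 2: "(1 + t) powr (b + 1) * (1 + t) powr (- (b + 1)) = 1"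
        using t by (simp only: powr_add[symmetric]) simp
      have 3: "exp (1 / (4 * t)) * exp (- 1 / (4 * t)) = 1"
        by (simp only: exp_add[symmetric]) simp
      have "t powr (- b - 1) * exp (- 1 / (4 * t))
          = t powr (- b - 1) * exp (- 1 / (4 * t)) * ((1 + t) powr (b + 1) * (1 + t) powr (- (b + 1)))"
        unfolding 2 by simp
      also have "\<dots> = t powr (- b - 1) * (1 + t) powr (b + 1) * ((1 + t) powr (- (b + 1)) * exp (- 1 / (4 * t)))"
        by (simp only: mult_ac)
      also have "\<dots> \<le> k * exp (1 / (4 * t)) * ((1 + t) powr (- (b + 1)) * exp (- 1 / (4 * t)))"
        using 1 by (intro mult_right_mono) auto
      also have "\<dots> = k * (1 + t) powr (- (b + 1)) * (exp (1 / (4 * t)) * exp (- 1 / (4 * t)))"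
        by (simp only: mult_ac)
      also have "\<dots> = k * (1 + t) powr (- (b + 1))"
        unfolding 3 by simp
      finally show ?thesis .
    qed
    then show "f 1 t \<le> ennreal k * (ennreal (t powr (1 - 1) * (1 + t) powr (- (b + 1))) * indicator {0<..} t)"
      by (auto simp: f_def indicator_def ennreal_mult'[symmetric] k_def intro!: ennreal_leI)
  qed
  also have "\<dots> < \<infinity>"
    using nn_integral_powr_shift_finite[of 1 "b + 1"] assms
    by (subst nn_integral_cmult) (auto simp: ennreal_mult_less_top)
  finally have F: "F = ennreal (enn2real F)" by (simp add: less_top[symmetric])
  \<comment> \<open>On [1, 2] the two factors are bounded below separately: the power by its value
    at 2, the exponential by its value at 1.\<close>
  have "0 < F"
  proof -
    have "0 < ennreal (2 powr (- b - 1) * exp (- 1 / 4))" by simp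
    also have "\<dots> = (\<integral>\<^sup>+t. ennreal (2 powr (- b - 1) * exp (- 1 / 4)) * indicator {1..2} (t::real) \<partial>lborel)"
      by (subst nn_integral_cmult_indicator) auto
    also have "\<dots> \<le> F"
      unfolding F_def f_def
    proof (rule nn_integral_mono)
      fix t :: real
      have "2 powr (- b - 1) * exp (- 1 / 4) \<le> t powr (- b - 1) * exp (- 1 / (4 * t))" if "1 \<le> t" "t \<le> 2"
        using that assms by (intro mult_mono powr_mono2') auto
      then show "ennreal (2 powr (- b - 1) * exp (- 1 / 4)) * indicator {1..2} t
          \<le> ennreal (t powr (- b - 1) * exp (- 1 / (4 * t))) * indicator {0<..} t"
        by (auto simp: indicator_def intro!: ennreal_leI)
    qed
    finally show ?thesis .
  qed
  then have pos: "0 < enn2real F" by (subst (asm) F) simp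
  have "(\<integral>\<^sup>+t. f Q t \<partial>lborel) = ennreal (enn2real F * Q powr (- b))" if Q: "Q > 0" for Q
  proof -
    have *: "f Q (0 + Q * t) = ennreal (Q powr (- b - 1)) * f 1 t" for t
      using Q by (auto simp: f_def indicator_def zero_less_mult_iff ennreal_mult'[symmetric] powr_mult mult_ac)
    have "(\<integral>\<^sup>+t. f Q t \<partial>lborel) = \<bar>Q\<bar> * (\<integral>\<^sup>+t. f Q (0 + Q * t) \<partial>lborel)"
      using Q by (intro nn_integral_real_affine) auto
    also have "\<dots> = ennreal Q * (ennreal (Q powr (- b - 1)) * F)"
      using Q unfolding * F_def by (subst nn_integral_cmult) auto
    also have "\<dots> = ennreal (Q * (Q powr (- b - 1) * enn2real F))"
      using Q by (subst F) (simp add: ennreal_mult[symmetric])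
    also have "Q * (Q powr (- b - 1) * enn2real F) = enn2real F * Q powr (- b)"
      using Q by (simp add: powr_diff)
    finally show ?thesis .
  qed
  with pos show ?thesis by (auto simp: f_def)
qed

subsection \<open>Poisson's integral for the Bessel function\<close>

text \<open>The duplication formula at half-integers, by induction from Gamma(1/2). It turns the 4^k
  k! of the Bessel series into the (2k)! of the cosh series.\<close>

lemma Gamma_half_plus_nat:
  "Gamma (real k + 1 / 2) * (4 ^ k * fact k) = sqrt pi * fact (2 * k)"
proof (induction k)
  case (Suc k)
  have "Gamma (real (Suc k) + 1 / 2) = (real k + 1 / 2) * Gamma (real k + 1 / 2)"
    using Gamma_plus1[of "real k + 1 / 2"] nonpos_Ints_nonpos[of "real k + 1 / 2"] by (auto simp: add_ac)
  then have "Gamma (real (Suc k) + 1 / 2) * (4 ^ Suc k * fact (Suc k))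
     = (real k + 1 / 2) * (4 * real (Suc k)) * (Gamma (real k + 1 / 2) * (4 ^ k * fact k))"
    by simp
  also have "\<dots> = sqrt pi * fact (2 * Suc k)"
    unfolding Suc.IH by (simp add: algebra_simps)
  finally show ?case .
qed (simp add: Gamma_one_half_real)

lemma cosh_sums: "(\<lambda>k. x ^ (2 * k) / fact (2 * k)) sums cosh (x::real)"
proof -
  have "(\<lambda>k. if even (2 * k) then x ^ (2 * k) /\<^sub>R fact (2 * k) else 0) sums cosh x"
    using cosh_converges[of x]
    by (subst (asm) sums_mono_reindex[of "\<lambda>k. 2 * k", symmetric])
       (auto simp: strict_mono_def elim!: evenE)
  then show ?thesis by (simp add: field_simps)
qed

lemma nn_integral_Beta:
  fixes a b :: real
  assumes "0 < a" "0 < b"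
  shows "(\<integral>\<^sup>+v. ennreal (v powr (a - 1) * (1 - v) powr (b - 1)) * indicator {0<..<1} v \<partial>lborel)
    = ennreal (Beta a b)"
  using has_integral_Beta_real[OF assms]
  by (intro nn_integral_has_integral_lebesgue') (auto simp: has_integral_Icc_iff_Ioo)

text \<open>
  The weight \<open>(1 - s\<^sup>2)\<^sup>\<lambda>\<^sup>-\<^sup>1 ds\<close> of Poisson's integral for \<open>I\<^sub>\<lambda>\<^sub>-\<^sub>1\<^sub>/\<^sub>2\<close> on each half of \<open>[-1, 1]\<close>, in the
  variable \<open>v = 1 - s\<^sup>2\<close>; the two halves correspond to \<open>s = \<plusminus>\<surd>(1 - v)\<close>.
\<close>

definition poisson_weight :: "real \<Rightarrow> real \<Rightarrow> real" where
  "poisson_weight lam v = v powr (lam - 1) * (1 - v) powr (- (1 / 2))"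

lemma poisson_weight_nonneg [simp]: "0 \<le> poisson_weight lam v"
  by (simp add: poisson_weight_def)

lemma poisson_weight_measurable [measurable]: "poisson_weight lam \<in> borel_measurable borel"
  unfolding poisson_weight_def by measurable

lemma nn_integral_poisson_weight:
  assumes "0 < lam"
  shows "(\<integral>\<^sup>+v. ennreal (poisson_weight lam v) * indicator {0<..<1} v \<partial>lborel) = ennreal (Beta lam (1 / 2))"
  using nn_integral_Beta[of lam "1/2"] assms by (simp add: poisson_weight_def)

text \<open>As B(\<lambda>, k + 1/2) = Gamma(\<lambda>) Gamma(k + 1/2) / Gamma(\<lambda> + k + 1/2),
  the reciprocal Gamma value of the series is a multiple of a Beta integral; what is left is the
  k-th term of cosh and a factor free of \<open>k\<close>.\<close>

lemma bessel_I_summand: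
  fixes lam z :: real
  assumes "0 < lam" "0 < z"
  shows "(z / 2) powr (2 * real k + (lam - 1 / 2)) * rGamma (real k + (lam - 1 / 2) + 1) / fact k
    = (z / 2) powr (lam - 1 / 2) / (sqrt pi * Gamma lam)
        * (z ^ (2 * k) / fact (2 * k) * Beta lam (real k + 1 / 2))"
proof -
  have 1: "(z / 2) powr (2 * real k + (lam - 1 / 2)) = (z / 2) ^ (2 * k) * (z / 2) powr (lam - 1 / 2)"
    using assms powr_realpow[of "z / 2" "2 * k"] by (simp add: powr_add)
  have 2: "(z / 2) ^ (2 * k) = z ^ (2 * k) / 4 ^ k"
    by (simp add: power_divide power_mult)
  have 3: "rGamma (real k + (lam - 1 / 2) + 1) = 1 / Gamma (lam + (real k + 1 / 2))"
    by (simp add: rGamma_inverse_Gamma field_simps)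
  have G: "Gamma (real k + 1 / 2) = sqrt pi * fact (2 * k) / (4 ^ k * fact k)"
    using Gamma_half_plus_nat[of k] by (simp add: field_simps)
  have "Gamma lam > 0" "Gamma (lam + (real k + 1 / 2)) > 0"
    using assms by (auto intro: Gamma_real_pos)
  then show ?thesis
    unfolding 1 2 3 Beta_def G by (simp add: field_simps)
qed

text \<open>The k-th term of cosh(z sqrt(1 - v)) brings (1 - v)^k, so its weighted integral involves
  B(\<lambda>, k + 1/2) and is a multiple of the k-th term of the Bessel series. All terms are
  nonnegative, which justifies exchanging sum and integral.\<close>

lemma bessel_I_poisson:
  fixes lam z :: real
  assumes "0 < lam" "0 < z"
  shows "ennreal (bessel_I (lam - 1 / 2) z)
    = ennreal ((z / 2) powr (lam - 1 / 2) / (sqrt pi * Gamma lam))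
      * (\<integral>\<^sup>+v. ennreal (poisson_weight lam v * cosh (z * sqrt (1 - v))) * indicator {0<..<1} v \<partial>lborel)"
    and "0 \<le> bessel_I (lam - 1 / 2) z"
proof -
  define g where "g = (\<lambda>k. z ^ (2 * k) / fact (2 * k) * Beta lam (real k + 1 / 2))"
  define C where "C = (z / 2) powr (lam - 1 / 2) / (sqrt pi * Gamma lam)"
  have C: "C > 0" using assms by (auto simp: C_def)
  have Beta_pos: "Beta lam (real k + 1 / 2) > 0" for k
    using assms by (auto simp: Beta_def intro!: divide_pos_pos mult_pos_pos)
  then have g_nonneg: "0 \<le> g k" for k using less_imp_le[OF Beta_pos[of k]] assms by (simp add: g_def)
  have "(\<integral>\<^sup>+v. ennreal (poisson_weight lam v * cosh (z * sqrt (1 - v))) * indicator {0<..<1} v \<partial>lborel)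
    = (\<integral>\<^sup>+v. (\<Sum>k. ennreal (z ^ (2 * k) / fact (2 * k))
          * (ennreal (v powr (lam - 1) * (1 - v) powr ((real k + 1 / 2) - 1)) * indicator {0<..<1} v)) \<partial>lborel)"
  proof (rule nn_integral_cong)
    fix v :: real
    show "ennreal (poisson_weight lam v * cosh (z * sqrt (1 - v))) * indicator {0<..<1} v
     = (\<Sum>k. ennreal (z ^ (2 * k) / fact (2 * k))
          * (ennreal (v powr (lam - 1) * (1 - v) powr ((real k + 1 / 2) - 1)) * indicator {0<..<1} v))"
    proof (cases "v \<in> {0<..<1}")
      case True
      have "(\<lambda>k. poisson_weight lam v * ((z * sqrt (1 - v)) ^ (2 * k) / fact (2 * k)))
          sums (poisson_weight lam v * cosh (z * sqrt (1 - v)))"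
        by (intro sums_mult cosh_sums)
      moreover have "poisson_weight lam v * ((z * sqrt (1 - v)) ^ (2 * k) / fact (2 * k))
          = z ^ (2 * k) / fact (2 * k) * (v powr (lam - 1) * (1 - v) powr ((real k + 1 / 2) - 1))" for k
      proof -
        have "(1 - v) powr ((real k + 1 / 2) - 1) = (1 - v) ^ k * (1 - v) powr (- (1 / 2))"
          using True powr_realpow[of "1 - v" k] powr_add[of "1 - v" "real k" "- (1 / 2)"] by simp
        moreover have "sqrt (1 - v) ^ (2 * k) = (1 - v) ^ k"
          using True by (simp add: power_mult)
        ultimately show ?thesis by (simp add: poisson_weight_def power_mult_distrib)
      qed
      ultimately have "(\<lambda>k. z ^ (2 * k) / fact (2 * k) * (v powr (lam - 1) * (1 - v) powr ((real k + 1 / 2) - 1)))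
          sums (poisson_weight lam v * cosh (z * sqrt (1 - v)))" by simp
      then have "ennreal (poisson_weight lam v * cosh (z * sqrt (1 - v)))
          = (\<Sum>k. ennreal (z ^ (2 * k) / fact (2 * k) * (v powr (lam - 1) * (1 - v) powr ((real k + 1 / 2) - 1))))"
        by (intro suminf_ennreal_eq[symmetric]) (auto intro!: mult_nonneg_nonneg divide_nonneg_nonneg)
      then show ?thesis
        using True
        by (simp only: indicator_simps mult_1_right ennreal_mult''[symmetric] mult_nonneg_nonneg powr_ge_zero)
    qed simp
  qed
  also have "\<dots> = (\<Sum>k. ennreal (g k))"
  proof (subst nn_integral_suminf)
    fix k
    show "(\<Sum>k. \<integral>\<^sup>+v. ennreal (z ^ (2 * k) / fact (2 * k))
          * (ennreal (v powr (lam - 1) * (1 - v) powr ((real k + 1 / 2) - 1)) * indicator {0<..<1} v) \<partial>lborel)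
        = (\<Sum>k. ennreal (g k))"
    proof (rule suminf_cong)
      fix k
      have "(\<integral>\<^sup>+v. ennreal (z ^ (2 * k) / fact (2 * k))
          * (ennreal (v powr (lam - 1) * (1 - v) powr ((real k + 1 / 2) - 1)) * indicator {0<..<1} v) \<partial>lborel)
        = ennreal (z ^ (2 * k) / fact (2 * k)) * ennreal (Beta lam (real k + 1 / 2))"
        using nn_integral_Beta[of lam "real k + 1 / 2"] assms by (subst nn_integral_cmult) auto
      also have "\<dots> = ennreal (g k)"
        using assms less_imp_le[OF Beta_pos[of k]] by (simp add: g_def ennreal_mult[symmetric])
      finally show "(\<integral>\<^sup>+v. ennreal (z ^ (2 * k) / fact (2 * k))
          * (ennreal (v powr (lam - 1) * (1 - v) powr ((real k + 1 / 2) - 1)) * indicator {0<..<1} v) \<partial>lborel)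
        = ennreal (g k)" .
    qed
  qed auto
  finally have int: "(\<integral>\<^sup>+v. ennreal (poisson_weight lam v * cosh (z * sqrt (1 - v))) * indicator {0<..<1} v \<partial>lborel)
     = (\<Sum>k. ennreal (g k))" .
  \<comment> \<open>\<open>bessel_I\<close> is a real \<open>suminf\<close>, so summability has to
    be established first. It follows from bounding cosh by its value \<open>cosh z\<close> at v =
    0.\<close>
  have "summable g"
  proof (rule summable_suminf_not_top[OF g_nonneg])
    have "(\<Sum>k. ennreal (g k)) \<le> (\<integral>\<^sup>+v. ennreal (cosh z) * (ennreal (poisson_weight lam v) * indicator {0<..<1} v) \<partial>lborel)"
      unfolding int[symmetric]
    proof (rule nn_integral_mono)
      fix v :: real
      have "poisson_weight lam v * cosh (z * sqrt (1 - v)) \<le> cosh z * poisson_weight lam v" if "0 < v" "v < 1"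
      proof -
        have "z * sqrt (1 - v) \<le> z" using that assms by (simp add: mult_left_le)
        then have "cosh (z * sqrt (1 - v)) \<le> cosh z"
          using that assms by (subst cosh_real_nonneg_le_iff) auto
        from mult_left_mono[OF this poisson_weight_nonneg] show ?thesis
          by (simp only: mult.commute[of "cosh z"])
      qed
      then show "ennreal (poisson_weight lam v * cosh (z * sqrt (1 - v))) * indicator {0<..<1} v
         \<le> ennreal (cosh z) * (ennreal (poisson_weight lam v) * indicator {0<..<1} v)"
        by (auto simp: indicator_def ennreal_mult'[symmetric] intro!: ennreal_leI)
    qed
    also have "\<dots> < \<infinity>"
      using nn_integral_poisson_weight[OF assms(1)] 
      by (subst nn_integral_cmult) (auto simp: ennreal_mult_less_top)
    finally show "(\<Sum>k. ennreal (g k)) \<noteq> top" by simp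
  qed
  then have g: "(\<Sum>k. ennreal (g k)) = ennreal (suminf g)" "0 \<le> suminf g"
    using g_nonneg by (auto intro: suminf_ennreal2 suminf_nonneg)
  have "bessel_I (lam - 1 / 2) z = (\<Sum>k. C * g k)"
    unfolding bessel_I_def bessel_I_summand[OF assms] C_def g_def ..
  also have "\<dots> = C * suminf g"
    using \<open>summable g\<close> by (rule suminf_mult)
  finally have eq: "bessel_I (lam - 1 / 2) z = C * suminf g" .
  show "0 \<le> bessel_I (lam - 1 / 2) z" unfolding eq using C g(2) by simp
  show "ennreal (bessel_I (lam - 1 / 2) z)
    = ennreal ((z / 2) powr (lam - 1 / 2) / (sqrt pi * Gamma lam))
      * (\<integral>\<^sup>+v. ennreal (poisson_weight lam v * cosh (z * sqrt (1 - v))) * indicator {0<..<1} v \<partial>lborel)"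
    unfolding int g(1) eq C_def[symmetric] using C g(2) by (simp add: ennreal_mult)
qed

subsection \<open>The kernel as a Poisson integral\<close>

text \<open>
  For \<open>\<bar>s\<bar> \<le> 1\<close> this is the squared distance from \<open>(x, 0)\<close> to \<open>(y', s b, b \<surd>(1 - s\<^sup>2))\<close> in one more
  dimension, where \<open>y = (y', b)\<close>; hence its square root is 1-Lipschitz in \<open>x\<close>.
\<close>

definition rot_dist_sq :: "real ^ 'm::{finite,linorder} \<Rightarrow> real ^ 'm::{finite,linorder} \<Rightarrow> real \<Rightarrow> real" where
  "rot_dist_sq x y s = (\<Sum>i\<in>UNIV - {Max UNIV}. (x $ i - y $ i)\<^sup>2)
     + (last_coord x)\<^sup>2 + (last_coord y)\<^sup>2 - 2 * s * last_coord x * last_coord y"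

lemma dist_sq_last_coord:
  fixes x y :: "real ^ 'm::{finite,linorder}"
  shows "(dist x y)\<^sup>2 = (\<Sum>i\<in>UNIV - {Max UNIV}. (x $ i - y $ i)\<^sup>2) + (last_coord x - last_coord y)\<^sup>2"
proof -
  have "(dist x y)\<^sup>2 = (\<Sum>i\<in>UNIV. (x $ i - y $ i)\<^sup>2)"
    by (simp add: dist_vec_def L2_set_def dist_real_def sum_nonneg)
  also have "\<dots> = (x $ Max UNIV - y $ Max UNIV)\<^sup>2 + (\<Sum>i\<in>UNIV - {Max UNIV}. (x $ i - y $ i)\<^sup>2)"
    by (rule sum.remove) auto
  finally show ?thesis by (simp add: last_coord_def)
qed

lemma rot_dist_sq_eq_dist:
  "rot_dist_sq x y s = (dist x y)\<^sup>2 + 2 * last_coord x * last_coord y * (1 - s)"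
  unfolding dist_sq_last_coord rot_dist_sq_def by (simp add: power2_eq_square algebra_simps)

lemma dist_sq_le_rot_dist_sq:
  assumes "x \<in> upper_half_space" "y \<in> upper_half_space" "s \<le> 1"
  shows "(dist x y)\<^sup>2 \<le> rot_dist_sq x y s"
  using assms by (simp add: rot_dist_sq_eq_dist upper_half_space_def)

lemma sqrt_rot_dist_sq_lipschitz:
  fixes x x' y :: "real ^ 'm::{finite,linorder}"
  assumes "\<bar>s\<bar> \<le> 1"
  shows "\<bar>sqrt (rot_dist_sq x y s) - sqrt (rot_dist_sq x' y s)\<bar> \<le> dist x x'"
proof -
  \<comment> \<open>\<open>z\<close> and \<open>k\<close> split the point of one more dimension
    described at \<open>rot_dist_sq\<close>: \<open>z\<close> lies in the original space and
    \<open>k\<close> is the additional coordinate. The distance then becomes a norm in the product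
    space, where the reverse triangle inequality applies.\<close>
  define z where "z = (\<chi> i. if i = Max UNIV then s * last_coord y else y $ i)"
  define k where "k = last_coord y * sqrt (1 - s\<^sup>2)"
  have "s\<^sup>2 \<le> 1" using assms by (simp add: abs_square_le_1)
  then have k2: "k\<^sup>2 = (last_coord y)\<^sup>2 * (1 - s\<^sup>2)" by (simp add: k_def power_mult_distrib)
  have "rot_dist_sq w y s = (dist w z)\<^sup>2 + k\<^sup>2" for w
  proof -
    have "(\<Sum>i\<in>UNIV - {Max UNIV}. (w $ i - z $ i)\<^sup>2) = (\<Sum>i\<in>UNIV - {Max UNIV}. (w $ i - y $ i)\<^sup>2)"
      by (intro sum.cong) (auto simp: z_def)
    moreover have "last_coord z = s * last_coord y" by (simp add: z_def last_coord_def)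
    ultimately show ?thesis
      unfolding dist_sq_last_coord k2 rot_dist_sq_def by (simp add: power2_eq_square algebra_simps)
  qed
  then have *: "sqrt (rot_dist_sq w y s) = norm (w - z, k)" for w
    by (simp add: norm_Pair dist_norm)
  have "\<bar>norm (x - z, k) - norm (x' - z, k)\<bar> \<le> norm ((x - z, k) - (x' - z, k))"
    by (rule norm_triangle_ineq3)
  also have "\<dots> = dist x x'" by (simp add: norm_Pair dist_norm)
  finally show ?thesis unfolding * .
qed

text \<open>The Poisson integrand for the exponent \<open>b\<close>, folded onto v = 1 - s^2 by
  adding the values at the two roots s. As |ds| = dv/(2 sqrt(1 - v)), its integral over (0, 1) is
  twice the integral over -1 < s < 1.\<close>

definition riesz_density ::
    "real \<Rightarrow> real \<Rightarrow> real ^ 'm::{finite,linorder} \<Rightarrow> real ^ 'm::{finite,linorder} \<Rightarrow> real \<Rightarrow> real" where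
  "riesz_density lam b x y v = poisson_weight lam v *
     (rot_dist_sq x y (sqrt (1 - v)) powr (- b) + rot_dist_sq x y (- sqrt (1 - v)) powr (- b))"

lemma riesz_density_nonneg [simp]: "0 \<le> riesz_density lam b x y v"
  by (simp add: riesz_density_def)

lemma riesz_density_measurable [measurable]: "riesz_density lam b x y \<in> borel_measurable borel"
  unfolding riesz_density_def rot_dist_sq_def by measurable

text \<open>Off the diagonal Q_s \<ge> D^2 > 0, so both powers are bounded and a multiple of the
  weight dominates.\<close>

lemma riesz_density_integrable:
  fixes x y :: "real ^ 'm::{finite,linorder}"
  assumes "0 < lam" "0 < b" "x \<in> upper_half_space" "y \<in> upper_half_space" "x \<noteq> y"
  shows "set_integrable lborel {0<..<1} (riesz_density lam b x y)"
proof -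
  have "(\<integral>\<^sup>+v. ennreal (indicator {0<..<1} v * riesz_density lam b x y v) \<partial>lborel)
    \<le> (\<integral>\<^sup>+v. ennreal (2 * ((dist x y)\<^sup>2) powr (- b)) * (ennreal (poisson_weight lam v) * indicator {0<..<1} v) \<partial>lborel)"
  proof (rule nn_integral_mono)
    fix v :: real
    have "riesz_density lam b x y v \<le> 2 * ((dist x y)\<^sup>2) powr (- b) * poisson_weight lam v" if "0 < v" "v < 1"
    proof -
      have s: "sqrt (1 - v) \<le> 1" "- sqrt (1 - v) \<le> 1" using that
        by (auto intro: order_trans[of _ 0])
      have "rot_dist_sq x y s powr (- b) \<le> ((dist x y)\<^sup>2) powr (- b)" if "s \<le> 1" for s
        using assms that by (intro powr_mono2' dist_sq_le_rot_dist_sq) auto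
      from this[OF s(1)] this[OF s(2)]
      have "rot_dist_sq x y (sqrt (1 - v)) powr (- b) + rot_dist_sq x y (- sqrt (1 - v)) powr (- b)
          \<le> 2 * ((dist x y)\<^sup>2) powr (- b)" by linarith
      from mult_left_mono[OF this poisson_weight_nonneg] show ?thesis
        by (simp only: riesz_density_def mult.commute)
    qed
    then show "ennreal (indicator {0<..<1} v * riesz_density lam b x y v)
        \<le> ennreal (2 * ((dist x y)\<^sup>2) powr (- b)) * (ennreal (poisson_weight lam v) * indicator {0<..<1} v)"
      by (auto simp: indicator_def ennreal_mult''[symmetric] intro!: ennreal_leI)
  qed
  also have "\<dots> < \<infinity>"
    using nn_integral_poisson_weight[OF assms(1)]
    by (subst nn_integral_cmult) (auto simp: ennreal_mult_less_top)
  finally show ?thesis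
    unfolding set_integrable_def real_scaleR_def
    by (intro integrableI_nonneg) auto
qed

lemma nn_integral_riesz_density:
  assumes "0 < lam" "0 < b" "x \<in> upper_half_space" "y \<in> upper_half_space" "x \<noteq> y"
  shows "(\<integral>\<^sup>+v. ennreal (riesz_density lam b x y v) * indicator {0<..<1} v \<partial>lborel)
      = ennreal (LINT v:{0<..<1}|lborel. riesz_density lam b x y v)"
    and "0 \<le> (LINT v:{0<..<1}|lborel. riesz_density lam b x y v)"
proof -
  show "(\<integral>\<^sup>+v. ennreal (riesz_density lam b x y v) * indicator {0<..<1} v \<partial>lborel)
      = ennreal (LINT v:{0<..<1}|lborel. riesz_density lam b x y v)"
    unfolding set_lebesgue_integral_def
    using riesz_density_integrable[OF assms]
    by (subst nn_integral_eq_integral[symmetric])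
       (auto simp: set_integrable_def indicator_def intro!: nn_integral_cong)
  show "0 \<le> (LINT v:{0<..<1}|lborel. riesz_density lam b x y v)"
    unfolding set_lebesgue_integral_def by (rule integral_nonneg_AE) auto
qed

text \<open>\<open>s\<close> will be sqrt(1 - v) and \<open>G\<close> will be sqrt(pi)
  Gamma(\<lambda>). The powers of a c cancel. The two exponentials in cosh complete -(S + a^2 +
  c^2)/(4 t) to -Q/(4 t) at \<open>s\<close> and at \<open>- s\<close>. The exponents of
  \<open>t\<close>, namely -n/2, -1, 1/2 - \<lambda> and \<alpha>/2 - 1, add up to -\<beta> -
  1.\<close>

lemma heat_kernel_factor:
  fixes S a c t s lam \<alpha> n :: real
  assumes "0 < a" "0 < c" "0 < t"
  shows "exp (- S / (4 * t)) / (4 * pi * t) powr (n / 2)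
     * ((a * c) powr (- lam + 1 / 2) / (2 * t)) * exp (- (a\<^sup>2 + c\<^sup>2) / (4 * t))
     * ((a * c / (2 * t) / 2) powr (lam - 1 / 2) / G)
     / t powr (1 - \<alpha> / 2) * cosh (a * c / (2 * t) * s)
   = (4 * pi) powr (- (n / 2)) * 4 powr (1 / 2 - lam) / (4 * G)
     * (t powr (- ((n + 1) / 2 + lam - \<alpha> / 2) - 1)
        * (exp (- (S + a\<^sup>2 + c\<^sup>2 - 2 * s * a * c) / (4 * t)) + exp (- (S + a\<^sup>2 + c\<^sup>2 - 2 * (- s) * a * c) / (4 * t))))"
proof -
  define w where "w = a * c / (2 * t) * s"
  have e: "exp (- S / (4 * t)) * exp (- (a\<^sup>2 + c\<^sup>2) / (4 * t)) * cosh w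
     = (exp (- (S + a\<^sup>2 + c\<^sup>2 - 2 * s * a * c) / (4 * t)) + exp (- (S + a\<^sup>2 + c\<^sup>2 - 2 * (- s) * a * c) / (4 * t))) / 2"
  proof -
    have "- (S + a\<^sup>2 + c\<^sup>2 - 2 * s * a * c) / (4 * t) = - S / (4 * t) + - (a\<^sup>2 + c\<^sup>2) / (4 * t) + w"
         "- (S + a\<^sup>2 + c\<^sup>2 - 2 * (- s) * a * c) / (4 * t) = - S / (4 * t) + - (a\<^sup>2 + c\<^sup>2) / (4 * t) + - w"
      using assms by (simp_all add: w_def field_simps)
    then show ?thesis
      unfolding cosh_def by (simp only: exp_add) (simp add: algebra_simps)
  qed
  have p1: "(4 * pi * t) powr (n / 2) = (4 * pi) powr (n / 2) * t powr (n / 2)"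
    using assms by (simp add: powr_mult)
  have p2: "(a * c / (2 * t) / 2) powr (lam - 1 / 2) = (a * c) powr (lam - 1 / 2) * 4 powr (1 / 2 - lam) * t powr (1 / 2 - lam)"
  proof -
    have "a * c / (2 * t) / 2 = (a * c) / (4 * t)" by simp
    then have "(a * c / (2 * t) / 2) powr (lam - 1 / 2) = (a * c) powr (lam - 1 / 2) / (4 * t) powr (lam - 1 / 2)"
      using assms by (simp only: powr_divide) 
    also have "\<dots> = (a * c) powr (lam - 1 / 2) * (4 * t) powr (- (lam - 1 / 2))"
      by (simp only: powr_minus divide_inverse)
    also have "(4 * t) powr (- (lam - 1 / 2)) = 4 powr (1 / 2 - lam) * t powr (1 / 2 - lam)"
      using assms by (simp add: powr_mult)
    finally show ?thesis by simp
  qed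
  have p3: "(a * c) powr (- lam + 1 / 2) * (a * c) powr (lam - 1 / 2) = 1"
    using assms by (simp only: powr_add[symmetric]) simp
  have p4: "t powr (- ((n + 1) / 2 + lam - \<alpha> / 2) - 1)
     = inverse (t powr (n / 2)) * (inverse t * (t powr (1 / 2 - lam) * inverse (t powr (1 - \<alpha> / 2))))"
  proof -
    have ex: "- ((n + 1) / 2 + lam - \<alpha> / 2) - 1 = - (n / 2) + (- 1 + ((1 / 2 - lam) + (- (1 - \<alpha> / 2))))"
      by (simp add: field_simps)
    have "t powr (- ((n + 1) / 2 + lam - \<alpha> / 2) - 1)
      = t powr (- (n / 2)) * (t powr (- 1) * (t powr (1 / 2 - lam) * t powr (- (1 - \<alpha> / 2))))"
      unfolding ex powr_add ..
    moreover have "t powr (- 1) = inverse t" using assms by (simp add: powr_minus)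
    ultimately show ?thesis by (simp only: powr_minus)
  qed
  have "exp (- S / (4 * t)) / (4 * pi * t) powr (n / 2)
     * ((a * c) powr (- lam + 1 / 2) / (2 * t)) * exp (- (a\<^sup>2 + c\<^sup>2) / (4 * t))
     * ((a * c / (2 * t) / 2) powr (lam - 1 / 2) / G)
     / t powr (1 - \<alpha> / 2) * cosh (a * c / (2 * t) * s)
    = inverse ((4 * pi) powr (n / 2)) * 4 powr (1 / 2 - lam) / (2 * G)
      * ((a * c) powr (- lam + 1 / 2) * (a * c) powr (lam - 1 / 2))
      * (inverse (t powr (n / 2)) * (inverse t * (t powr (1 / 2 - lam) * inverse (t powr (1 - \<alpha> / 2)))))
      * (exp (- S / (4 * t)) * exp (- (a\<^sup>2 + c\<^sup>2) / (4 * t)) * cosh w)"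
    unfolding p1 p2 w_def[symmetric] by (simp only: divide_inverse inverse_mult_distrib mult_ac)
  also have "\<dots> = (4 * pi) powr (- (n / 2)) * 4 powr (1 / 2 - lam) / (4 * G)
     * (t powr (- ((n + 1) / 2 + lam - \<alpha> / 2) - 1)
        * (exp (- (S + a\<^sup>2 + c\<^sup>2 - 2 * s * a * c) / (4 * t)) + exp (- (S + a\<^sup>2 + c\<^sup>2 - 2 * (- s) * a * c) / (4 * t))))"
    unfolding p3 p4[symmetric] e by (simp only: powr_minus) simp
  finally show ?thesis .
qed

lemma cosh_measurable [measurable]: "(cosh :: real \<Rightarrow> real) \<in> borel_measurable borel"
  by (intro borel_measurable_continuous_onI continuous_intros)

lemma bessel_I_measurable [measurable]: "bessel_I \<nu> \<in> borel_measurable borel"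
  unfolding bessel_I_def by measurable

lemma last_coord_measurable [measurable]:
  "(last_coord :: real ^ 'm::{finite,linorder} \<Rightarrow> real) \<in> borel_measurable borel"
proof -
  have "continuous_on UNIV (last_coord :: real ^ 'm::{finite,linorder} \<Rightarrow> real)"
    unfolding last_coord_def by (intro continuous_intros)
  then show ?thesis by (rule borel_measurable_continuous_onI)
qed

text \<open>Phrased with nonnegative integrals so that Tonelli's theorem can exchange the integrals
  in \<open>t\<close> and \<open>v\<close>; nonnegativity of the heat kernel brings the result back
  to \<open>LINT\<close>.\<close>

lemma bessel_heat_kernel_poisson:
  fixes x y :: "real ^ 'm::{finite,linorder}" and lam \<alpha> t :: real
  defines "b \<equiv> real CARD('m) / 2 + lam - \<alpha> / 2"
    and "C \<equiv> (4 * pi) powr (- (real (CARD('m) - 1) / 2)) * 4 powr (1 / 2 - lam) / (4 * (sqrt pi * Gamma lam))"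
  assumes "0 < lam" "x \<in> upper_half_space" "y \<in> upper_half_space" "0 < t"
  shows "0 \<le> bessel_heat_kernel lam t x y"
    and "ennreal (bessel_heat_kernel lam t x y / t powr (1 - \<alpha> / 2))
      = (\<integral>\<^sup>+v. ennreal (C * poisson_weight lam v) * (ennreal (t powr (- b - 1) *
          exp (- rot_dist_sq x y (sqrt (1 - v)) / (4 * t)))
        + ennreal (t powr (- b - 1) *
          exp (- rot_dist_sq x y (- sqrt (1 - v)) / (4 * t)))) * indicator {0<..<1} v \<partial>lborel)"
proof -
  define n where "n = real (CARD('m) - 1)"
  define S where "S = (\<Sum>i\<in>UNIV - {Max UNIV}. (x $ i - y $ i)\<^sup>2)"
  define a c where "a = last_coord x" and "c = last_coord y"
  define z where "z = a * c / (2 * t)"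
  define D where "D = exp (- S / (4 * t)) / (4 * pi * t) powr (n / 2)
     * ((a * c) powr (- lam + 1 / 2) / (2 * t)) * exp (- (a\<^sup>2 + c\<^sup>2) / (4 * t))"
  have "0 < CARD('m)" by simp
  then have n: "n + 1 = real CARD('m)" unfolding n_def by linarith
  have ac: "0 < a" "0 < c" using assms by (auto simp: a_def c_def upper_half_space_def)
  then have z: "0 < z" using assms by (simp add: z_def)
  have G: "0 < Gamma lam" using assms by simp
  have D0: "0 \<le> D" using assms by (simp add: D_def)
  have C0: "0 \<le> C" using G by (simp add: C_def)
  have p: "bessel_heat_kernel lam t x y = D * bessel_I (lam - 1 / 2) z"
    by (simp add: bessel_heat_kernel_def D_def z_def S_def n_def a_def c_def)
  note I = bessel_I_poisson[OF \<open>0 < lam\<close> z]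
  show "0 \<le> bessel_heat_kernel lam t x y" unfolding p using D0 I(2) by simp
  have "ennreal (bessel_heat_kernel lam t x y / t powr (1 - \<alpha> / 2))
    = ennreal (D / t powr (1 - \<alpha> / 2)) * ennreal (bessel_I (lam - 1 / 2) z)"
    unfolding p using D0 I(2) by (simp add: ennreal_mult[symmetric])
  also have "\<dots> = ennreal (D * ((z / 2) powr (lam - 1 / 2) / (sqrt pi * Gamma lam)) / t powr (1 - \<alpha> / 2))
     * (\<integral>\<^sup>+v. ennreal (poisson_weight lam v * cosh (z * sqrt (1 - v))) * indicator {0<..<1} v \<partial>lborel)"
    unfolding I(1) mult.assoc[symmetric] using D0 G
    by (subst ennreal_mult[symmetric]) (auto simp: mult_ac)
  also have "\<dots> = (\<integral>\<^sup>+v. ennreal (D * ((z / 2) powr (lam - 1 / 2) / (sqrt pi * Gamma lam)) / t powr (1 - \<alpha> / 2))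
      * (ennreal (poisson_weight lam v * cosh (z * sqrt (1 - v))) * indicator {0<..<1} v) \<partial>lborel)"
    by (subst nn_integral_cmult) auto
  also have "\<dots> = (\<integral>\<^sup>+v. ennreal (C * poisson_weight lam v) * (ennreal (t powr (- b - 1) *
          exp (- rot_dist_sq x y (sqrt (1 - v)) / (4 * t)))
        + ennreal (t powr (- b - 1) *
          exp (- rot_dist_sq x y (- sqrt (1 - v)) / (4 * t)))) * indicator {0<..<1} v \<partial>lborel)"
  proof (rule nn_integral_cong)
    fix v :: real
    have H: "D * ((z / 2) powr (lam - 1 / 2) / (sqrt pi * Gamma lam)) / t powr (1 - \<alpha> / 2) * cosh (z * sqrt (1 - v))
      = C * (t powr (- b - 1) * (exp (- rot_dist_sq x y (sqrt (1 - v)) / (4 * t))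
                + exp (- rot_dist_sq x y (- sqrt (1 - v)) / (4 * t))))"
      using heat_kernel_factor[OF ac \<open>0 < t\<close>, of S n lam "sqrt pi * Gamma lam" \<alpha> "sqrt (1 - v)"]
      unfolding n D_def z_def C_def b_def n_def[symmetric] rot_dist_sq_def S_def[symmetric] a_def[symmetric] c_def[symmetric] .
    have "ennreal (D * ((z / 2) powr (lam - 1 / 2) / (sqrt pi * Gamma lam)) / t powr (1 - \<alpha> / 2))
        * ennreal (poisson_weight lam v * cosh (z * sqrt (1 - v)))
      = ennreal (D * ((z / 2) powr (lam - 1 / 2) / (sqrt pi * Gamma lam)) / t powr (1 - \<alpha> / 2)
         * cosh (z * sqrt (1 - v)) * poisson_weight lam v)"
      by (subst ennreal_mult''[symmetric]) (auto simp: mult_ac)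
    also have "\<dots> = ennreal (C * poisson_weight lam v * (t powr (- b - 1) * exp (- rot_dist_sq x y (sqrt (1 - v)) / (4 * t))
                + t powr (- b - 1) * exp (- rot_dist_sq x y (- sqrt (1 - v)) / (4 * t))))"
      unfolding H by (rule arg_cong[where f = ennreal]) (simp only: distrib_left mult_ac)
    also have "\<dots> = ennreal (C * poisson_weight lam v) * (ennreal (t powr (- b - 1) *
          exp (- rot_dist_sq x y (sqrt (1 - v)) / (4 * t)))
        + ennreal (t powr (- b - 1) *
          exp (- rot_dist_sq x y (- sqrt (1 - v)) / (4 * t))))"
      using C0 by (subst ennreal_mult) (auto simp: ennreal_plus)
    finally show "ennreal (D * ((z / 2) powr (lam - 1 / 2) / (sqrt pi * Gamma lam)) / t powr (1 - \<alpha> / 2))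
      * (ennreal (poisson_weight lam v * cosh (z * sqrt (1 - v))) * indicator {0<..<1} v)
      = ennreal (C * poisson_weight lam v) * (ennreal (t powr (- b - 1) *
          exp (- rot_dist_sq x y (sqrt (1 - v)) / (4 * t)))
        + ennreal (t powr (- b - 1) *
          exp (- rot_dist_sq x y (- sqrt (1 - v)) / (4 * t)))) * indicator {0<..<1} v"
      by (simp only: mult.assoc[symmetric])
  qed
  finally show "ennreal (bessel_heat_kernel lam t x y / t powr (1 - \<alpha> / 2)) = \<dots>" .
qed

lemma bessel_heat_kernel_measurable:
  "(\<lambda>t. bessel_heat_kernel lam t x y) \<in> borel_measurable borel"
  unfolding bessel_heat_kernel_def by measurable

text \<open>The \<open>t\<close>-integral turns each Gaussian into a power of Q, leaving only an
  integral against the Poisson weight. The same positive \<open>k\<close> serves all pairs, so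
  two-sided bounds carry over in both directions.\<close>

theorem frac_bessel_kernel_eq_riesz_integral:
  fixes lam \<alpha> :: real
  defines "b \<equiv> real CARD('m::{finite,linorder}) / 2 + lam - \<alpha> / 2"
  assumes lam: "0 < lam" and \<alpha>: "0 < \<alpha>" "\<alpha> < real CARD('m::{finite,linorder})"
  shows "\<exists>k>0. \<forall>x\<in>upper_half_space. \<forall>y\<in>upper_half_space. x \<noteq> (y :: real ^ 'm::{finite,linorder}) \<longrightarrow>
    frac_bessel_kernel lam \<alpha> x y = k * (LINT v:{0<..<1}|lborel. riesz_density lam b x y v)"
proof -
  have b: "0 < b" using assms by (simp add: b_def)
  obtain k where k: "k > 0" and k_int: "\<And>Q. Q > 0 \<Longrightarrow>
    (\<integral>\<^sup>+t. ennreal (t powr (- b - 1) * exp (- Q / (4 * t))) * indicator {0<..} t \<partial>lborel)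
      = ennreal (k * Q powr (- b))"
    using nn_integral_powr_exp_inverse_scale[OF b] by auto
  define C where "C = (4 * pi) powr (- (real (CARD('m) - 1) / 2)) * 4 powr (1 / 2 - lam) / (4 * (sqrt pi * Gamma lam))"
  have G: "0 < Gamma lam" "0 < Gamma (\<alpha> / 2)" using lam \<alpha> by auto
  have C: "0 < C" using G by (simp add: C_def)
  have "frac_bessel_kernel lam \<alpha> x y = C * k / Gamma (\<alpha> / 2) * (LINT v:{0<..<1}|lborel. riesz_density lam b x y v)"
    if x: "x \<in> upper_half_space" and y: "y \<in> upper_half_space" and xy: "x \<noteq> y" for x y :: "real ^ 'm::{finite,linorder}"
  proof -
    define f where "f = (\<lambda>s t::real. ennreal (t powr (- b - 1) * exp (- rot_dist_sq x y s / (4 * t))))"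
    define g where "g = (\<lambda>t v. ennreal (C * poisson_weight lam v) * (f (sqrt (1 - v)) t + f (- sqrt (1 - v)) t)
        * indicator {0<..<1} v * indicator {0<..} t)"
    define J where "J = (LINT v:{0<..<1}|lborel. riesz_density lam b x y v)"
    have J: "(\<integral>\<^sup>+v. ennreal (riesz_density lam b x y v) * indicator {0<..<1} v \<partial>lborel) = ennreal J" and J0: "0 \<le> J"
      unfolding J_def using nn_integral_riesz_density[OF lam b x y xy] by auto
    have [measurable]: "(\<lambda>p. f (h (snd p)) (fst p)) \<in> borel_measurable (borel \<Otimes>\<^sub>M borel)"
      if [measurable]: "h \<in> borel_measurable borel" for h
      unfolding f_def rot_dist_sq_def by measurable
    have meas: "case_prod g \<in> borel_measurable (lborel \<Otimes>\<^sub>M lborel)"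
      unfolding g_def case_prod_beta' by measurable
    have "(\<integral>\<^sup>+t. ennreal (indicator {0<..} t *\<^sub>R (bessel_heat_kernel lam t x y / t powr (1 - \<alpha> / 2))) \<partial>lborel)
      = (\<integral>\<^sup>+t. \<integral>\<^sup>+v. g t v \<partial>lborel \<partial>lborel)"
    proof (rule nn_integral_cong)
      fix t :: real
      show "ennreal (indicator {0<..} t *\<^sub>R (bessel_heat_kernel lam t x y / t powr (1 - \<alpha> / 2))) = (\<integral>\<^sup>+v. g t v \<partial>lborel)"
      proof (cases "0 < t")
        case True
        then show ?thesis
          using bessel_heat_kernel_poisson(2)[OF lam x y True, of \<alpha>] 
          by (simp add: g_def f_def C_def b_def)
      qed (simp add: g_def)
    qed
    also have "\<dots> = (\<integral>\<^sup>+v. \<integral>\<^sup>+t. g t v \<partial>lborel \<partial>lborel)"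
      by (rule lborel_pair.Fubini'[symmetric, OF meas])
    also have "\<dots> = (\<integral>\<^sup>+v. ennreal (C * k) * (ennreal (riesz_density lam b x y v) * indicator {0<..<1} v) \<partial>lborel)"
    proof (rule nn_integral_cong)
      fix v :: real
      show "(\<integral>\<^sup>+t. g t v \<partial>lborel) = ennreal (C * k) * (ennreal (riesz_density lam b x y v) * indicator {0<..<1} v)"
      proof (cases "v \<in> {0<..<1}")
        case True
        \<comment> \<open>For fixed \<open>v\<close> the inner integral is the scaling integral with
          Q = \<open>rot_dist_sq x y s\<close>, which is positive because \<open>x\<close> and
          \<open>y\<close> differ.\<close>
        have Q: "(\<integral>\<^sup>+t. f s t * indicator {0<..} t \<partial>lborel) = ennreal (k * rot_dist_sq x y s powr (- b))"
          if "s \<le> 1" for s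
          unfolding f_def
        proof (rule k_int)
          have "0 < (dist x y)\<^sup>2" using xy by simp
          also have "\<dots> \<le> rot_dist_sq x y s" using dist_sq_le_rot_dist_sq[OF x y that] .
          finally show "0 < rot_dist_sq x y s" .
        qed
        have s: "sqrt (1 - v) \<le> 1" "- sqrt (1 - v) \<le> 1" using True
          by (auto intro: order_trans[of _ 0])
        have [measurable]: "f s \<in> borel_measurable borel" for s unfolding f_def by measurable
        have "(\<integral>\<^sup>+t. g t v \<partial>lborel) = (\<integral>\<^sup>+t. ennreal (C * poisson_weight lam v) *
           (f (sqrt (1 - v)) t * indicator {0<..} t + f (- sqrt (1 - v)) t * indicator {0<..} t) \<partial>lborel)"
          using True by (intro nn_integral_cong) (simp add: g_def distrib_right mult.assoc)
        also have "\<dots> = ennreal (C * poisson_weight lam v) *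
            (ennreal (k * rot_dist_sq x y (sqrt (1 - v)) powr (- b)) + ennreal (k * rot_dist_sq x y (- sqrt (1 - v)) powr (- b)))"
          by (subst nn_integral_cmult, measurable, subst nn_integral_add) (simp_all add: Q[OF s(1)] Q[OF s(2)])
        also have "\<dots> = ennreal (C * poisson_weight lam v *
            (k * rot_dist_sq x y (sqrt (1 - v)) powr (- b) + k * rot_dist_sq x y (- sqrt (1 - v)) powr (- b)))"
          using C k by (subst ennreal_mult) (auto simp: ennreal_plus)
        also have "C * poisson_weight lam v *
            (k * rot_dist_sq x y (sqrt (1 - v)) powr (- b) + k * rot_dist_sq x y (- sqrt (1 - v)) powr (- b))
            = C * k * riesz_density lam b x y v"
          by (simp add: riesz_density_def algebra_simps)
        finally show ?thesis using True C k by (simp add: ennreal_mult)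
      qed (simp add: g_def)
    qed
    also have "\<dots> = ennreal (C * k) * ennreal J"
      unfolding J[symmetric] by (subst nn_integral_cmult) auto
    also have "\<dots> = ennreal (C * k * J)" using C k J0 by (simp add: ennreal_mult)
    finally have K: "(\<integral>\<^sup>+t. ennreal (indicator {0<..} t *\<^sub>R (bessel_heat_kernel lam t x y / t powr (1 - \<alpha> / 2))) \<partial>lborel)
      = ennreal (C * k * J)" .
    have [measurable]: "(\<lambda>t. bessel_heat_kernel lam t x y) \<in> borel_measurable borel"
      by (rule bessel_heat_kernel_measurable)
    have "(LINT t:{0<..}|lborel. bessel_heat_kernel lam t x y / t powr (1 - \<alpha> / 2)) = C * k * J"
      unfolding set_lebesgue_integral_def
      using C k J0 bessel_heat_kernel_poisson(1)[OF lam x y]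
      by (subst integral_eq_nn_integral, measurable) (simp add: indicator_def, unfold K, simp)
    then show ?thesis by (simp add: frac_bessel_kernel_def J_def)
  qed
  then show ?thesis
    using C k G by (intro exI[of _ "C * k / Gamma (\<alpha> / 2)"]) auto
qed

subsection \<open>Bounds for the Poisson integral\<close>

text \<open>Only the range 0 < v < w with w = E/(E + P), and there only the root s = sqrt(1 - v), is
  kept. As 1 - sqrt(1 - v) \<le> v and P v \<le> E, Q_s lies between E and 3 E; the weight is at
  least v^(\<lambda>-1), which integrates to w^\<lambda>/\<lambda>.\<close>

lemma riesz_integral_lower:
  fixes lam b :: real
  assumes "0 < lam" "0 < b" and x: "x \<in> upper_half_space" and y: "y \<in> upper_half_space" and xy: "x \<noteq> y"
  defines "E \<equiv> (dist x y)\<^sup>2" and "P \<equiv> last_coord x * last_coord y"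
  shows "3 powr (- b) / lam * (E powr (lam - b) * (E + P) powr (- lam))
    \<le> (LINT v:{0<..<1}|lborel. riesz_density lam b x y v)"
proof -
  define w where "w = E / (E + P)"
  have E: "0 < E" using xy by (simp add: E_def)
  have P: "0 < P" using x y by (simp add: P_def upper_half_space_def)
  have w: "0 < w" "w < 1" using E P by (auto simp: w_def)
  have "ennreal (3 powr (- b) / lam * (E powr (lam - b) * (E + P) powr (- lam)))
    = ennreal ((3 * E) powr (- b)) * ennreal (w powr lam / lam)"
    using E P assms by (simp add: w_def ennreal_mult[symmetric] powr_mult powr_divide powr_diff powr_minus field_simps)
  also have "\<dots> = (\<integral>\<^sup>+v. ennreal ((3 * E) powr (- b)) * (ennreal (v powr (lam - 1)) * indicator {0<..<w} v) \<partial>lborel)"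
    using nn_integral_powr_Ioo[OF \<open>0 < lam\<close>, of w] w by (subst nn_integral_cmult) auto
  also have "\<dots> \<le> (\<integral>\<^sup>+v. ennreal (riesz_density lam b x y v) * indicator {0<..<1} v \<partial>lborel)"
  proof (rule nn_integral_mono)
    fix v :: real
    have "(3 * E) powr (- b) * v powr (lam - 1) \<le> riesz_density lam b x y v" if v: "0 < v" "v < w"
    proof -
      have "1 - v \<le> sqrt (1 - v)"
        using v w by (intro real_le_rsqrt) (auto simp: power2_eq_square mult_left_le)
      then have "P * (1 - sqrt (1 - v)) \<le> P * v"
        using P by (intro mult_left_mono) auto
      moreover have "rot_dist_sq x y (sqrt (1 - v)) = E + 2 * (P * (1 - sqrt (1 - v)))"
        by (simp add: rot_dist_sq_eq_dist E_def P_def)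
      ultimately have "rot_dist_sq x y (sqrt (1 - v)) \<le> E + 2 * (P * v)" by linarith
      also have "P * v \<le> E"
      proof -
        have "P * v \<le> P * w" using v P by simp
        also have "\<dots> \<le> E" using E P by (simp add: w_def field_simps)
        finally show ?thesis .
      qed
      finally have "rot_dist_sq x y (sqrt (1 - v)) \<le> 3 * E" by simp
      moreover have "E \<le> rot_dist_sq x y (sqrt (1 - v))"
        unfolding E_def by (rule dist_sq_le_rot_dist_sq[OF x y]) (use v in auto)
      with E have "0 < rot_dist_sq x y (sqrt (1 - v))" by linarith
      ultimately have "(3 * E) powr (- b) \<le> rot_dist_sq x y (sqrt (1 - v)) powr (- b)"
        using assms by (intro powr_mono2') auto
      then have 1: "(3 * E) powr (- b) \<le> rot_dist_sq x y (sqrt (1 - v)) powr (- b)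
          + rot_dist_sq x y (- sqrt (1 - v)) powr (- b)"
        by (simp add: add_increasing2)
      have "1 powr (- (1 / 2)) \<le> (1 - v) powr (- (1 / 2))"
        using v w by (intro powr_mono2') auto
      then have 2: "v powr (lam - 1) \<le> poisson_weight lam v"
        using mult_left_mono[of 1 "(1 - v) powr (- (1 / 2))" "v powr (lam - 1)"]
        by (simp add: poisson_weight_def)
      show ?thesis
        using mult_mono[OF 2 1] by (simp add: riesz_density_def mult.commute)
    qed
    then show "ennreal ((3 * E) powr (- b)) * (ennreal (v powr (lam - 1)) * indicator {0<..<w} v)
        \<le> ennreal (riesz_density lam b x y v) * indicator {0<..<1} v"
      using w by (auto simp: indicator_def ennreal_mult'[symmetric] intro!: ennreal_leI)
  qed
  also have "\<dots> = ennreal (LINT v:{0<..<1}|lborel. riesz_density lam b x y v)"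
    using nn_integral_riesz_density[OF assms(1-5)] by simp
  finally show ?thesis
    using nn_integral_riesz_density(2)[OF assms(1-5)] by (simp add: ennreal_le_iff)
qed

text \<open>Expanding (1 - sqrt(1 - v))^2 \<ge> 0 gives v \<le> 2 (1 - sqrt(1 - v)), hence Q_s \<ge>
  E + P v at the positive root; at the negative root Q_s is at least as large.\<close>

lemma riesz_density_le:
  fixes lam b v :: real
  assumes "0 < lam" "0 < b" and x: "x \<in> upper_half_space" and y: "y \<in> upper_half_space" and xy: "x \<noteq> y"
    and v: "0 < v" "v < 1"
  defines "E \<equiv> (dist x y)\<^sup>2" and "P \<equiv> last_coord x * last_coord y"
  shows "riesz_density lam b x y v \<le> 2 * poisson_weight lam v * (E + P * v) powr (- b)"
proof -
  have E: "0 < E" using xy by (simp add: E_def)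
  have P: "0 < P" using x y by (simp add: P_def upper_half_space_def)
  have pos: "0 < E + P * v" using E P v by (intro add_pos_pos mult_pos_pos)
  have "0 \<le> (1 - sqrt (1 - v))\<^sup>2" by simp
  then have "v \<le> 2 * (1 - sqrt (1 - v))" using v by (simp add: power2_eq_square algebra_simps)
  then have 1: "E + P * v \<le> rot_dist_sq x y (sqrt (1 - v))"
    using mult_left_mono[of v "2 * (1 - sqrt (1 - v))" P] P
    by (simp add: rot_dist_sq_eq_dist E_def P_def mult_ac)
  have "2 * P * sqrt (1 - v) \<ge> - (2 * P * sqrt (1 - v))" using P v by simp
  then have 2: "rot_dist_sq x y (sqrt (1 - v)) \<le> rot_dist_sq x y (- sqrt (1 - v))"
    by (simp add: rot_dist_sq_eq_dist P_def algebra_simps)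
  have "rot_dist_sq x y (sqrt (1 - v)) powr (- b) \<le> (E + P * v) powr (- b)"
       "rot_dist_sq x y (- sqrt (1 - v)) powr (- b) \<le> (E + P * v) powr (- b)"
    using pos 1 2 assms by (auto intro!: powr_mono2')
  then have "rot_dist_sq x y (sqrt (1 - v)) powr (- b) + rot_dist_sq x y (- sqrt (1 - v)) powr (- b)
      \<le> 2 * (E + P * v) powr (- b)" by linarith
  from mult_left_mono[OF this poisson_weight_nonneg[of lam v]] show ?thesis
    by (simp add: riesz_density_def mult_ac)
qed

text \<open>Separates the endpoints 0 and 1, with the cut at 1/2. Near 0, E + P v is traded for E +
  (E + P) v: scaling with \<open>P\<close> alone would produce P^(-\<lambda>), too large when
  \<open>P\<close> is small compared with \<open>E\<close>. Away from 0, E + P v \<ge> (E + P)/2,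
  and the weight is left to be integrated as it is.\<close>

lemma poisson_weight_powr_le:
  fixes lam b v E P :: real
  assumes "0 < lam" "0 < b" "0 < v" "v < 1" "0 < E" "0 < P"
  shows "poisson_weight lam v * (E + P * v) powr (- b)
    \<le> 2 * 2 powr b * (v powr (lam - 1) * (E + (E + P) * v) powr (- b))
      + 2 powr b * (E + P) powr (- b) * poisson_weight lam v"
proof (cases "v < 1 / 2")
  case True
  \<comment> \<open>The bound 1 - v \<ge> 1/4 is cruder than v < 1/2 allows, but its root is exact
    and gives the constant 2.\<close>
  have "(1 - v) powr (- (1 / 2)) \<le> (1 / 4) powr (- (1 / 2))"
    using True by (intro powr_mono2') auto
  also have "(1 / 4 :: real) powr (- (1 / 2)) = 2"
  proof -
    have "(1 / 4 :: real) powr (- (1 / 2)) = (4 powr (- 1)) powr (- (1 / 2))" by (simp add: powr_minus)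
    also have "\<dots> = sqrt 4" by (simp only: powr_powr) (simp add: powr_half_sqrt)
    finally show ?thesis by simp
  qed
  finally have 1: "poisson_weight lam v \<le> 2 * v powr (lam - 1)"
    using mult_left_mono[of "(1 - v) powr (- (1 / 2))" 2 "v powr (lam - 1)"]
    by (simp add: poisson_weight_def mult.commute)
  have pos: "0 < E + (E + P) * v" using assms by (intro add_pos_pos mult_pos_pos) auto
  \<comment> \<open>As v < 1, E + (E + P) v \<le> 2 (E + P v). The next fact is stated for opaque
    \<open>e\<close> and \<open>p\<close> so that the products are atoms for linear
    arithmetic.\<close>
  have "E * v \<le> E" "0 < P * v" using assms by auto
  moreover have "(E + (e + p)) / 2 \<le> E + p" if "e \<le> E" "0 < p" for e p using that by simp
  ultimately have "(E + (E + P) * v) / 2 \<le> E + P * v" by (simp only: distrib_right)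
  then have "(E + P * v) powr (- b) \<le> ((E + (E + P) * v) / 2) powr (- b)"
    using pos assms by (intro powr_mono2') auto
  also have "\<dots> = 2 powr b * (E + (E + P) * v) powr (- b)"
    using pos by (simp add: powr_divide powr_minus field_simps)
  finally have "poisson_weight lam v * (E + P * v) powr (- b)
    \<le> 2 * v powr (lam - 1) * (2 powr b * (E + (E + P) * v) powr (- b))"
    by (intro mult_mono 1) auto
  then show ?thesis by (simp add: mult_ac add_increasing2)
next
  case False
  have "P \<le> P * (2 * v)" using False assms by simp
  then have "P \<le> 2 * (P * v)" by (simp add: mult_ac)
  moreover have "(E + P) / 2 \<le> E + p" if "P \<le> 2 * p" for p using that \<open>0 < E\<close> by simp
  ultimately have "(E + P) / 2 \<le> E + P * v" by simp
  then have "(E + P * v) powr (- b) \<le> ((E + P) / 2) powr (- b)"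
    using assms by (intro powr_mono2') auto
  also have "\<dots> = 2 powr b * (E + P) powr (- b)"
    using assms by (simp add: powr_divide powr_minus field_simps)
  finally have "poisson_weight lam v * (E + P * v) powr (- b)
    \<le> poisson_weight lam v * (2 powr b * (E + P) powr (- b))"
    by (intro mult_left_mono) auto
  then show ?thesis by (simp add: mult_ac add_increasing)
qed

text \<open>The first term of \<open>poisson_weight_powr_le\<close>, extended to the half-line, is
  the scaling integral with E + P in place of \<open>P\<close>; the second gives the Beta value
  \<open>B\<close>. The factor 2 of \<open>riesz_density_le\<close> doubles both, which explains
  \<open>C\<close>.\<close>

lemma riesz_integral_upper:
  fixes lam b :: real
  assumes lam: "0 < lam" and b: "lam < b"
  shows "\<exists>C>0. \<forall>x\<in>upper_half_space. \<forall>y\<in>upper_half_space. x \<noteq> y \<longrightarrow>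
    (LINT v:{0<..<1}|lborel. riesz_density lam b x y v)
      \<le> C * (((dist x y)\<^sup>2) powr (lam - b) * ((dist x y)\<^sup>2 + last_coord x * last_coord y) powr (- lam))"
proof -
  obtain M where M: "0 \<le> M" "\<And>E P. 0 < E \<Longrightarrow> 0 < P \<Longrightarrow>
    (\<integral>\<^sup>+v. ennreal (v powr (lam - 1) * (E + P * v) powr (- b)) * indicator {0<..} v \<partial>lborel)
      = ennreal (M * E powr (lam - b) * P powr (- lam))"
    using nn_integral_powr_shift_scale[OF lam b] by blast
  define B where "B = Beta lam (1 / 2)"
  have B: "0 < B" using lam by (auto simp: B_def Beta_def intro!: divide_pos_pos mult_pos_pos)
  define C where "C = 4 * 2 powr b * M + 2 * 2 powr b * B"
  have C: "0 < C" using M B by (auto simp: C_def intro!: add_nonneg_pos)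
  have b0: "0 < b" using lam b by simp
  have "(LINT v:{0<..<1}|lborel. riesz_density lam b x y v)
      \<le> C * (((dist x y)\<^sup>2) powr (lam - b) * ((dist x y)\<^sup>2 + last_coord x * last_coord y) powr (- lam))"
    if x: "x \<in> upper_half_space" and y: "y \<in> upper_half_space" and xy: "x \<noteq> y" for x y
  proof -
    define E where "E = (dist x y)\<^sup>2"
    define P where "P = last_coord x * last_coord y"
    have E: "0 < E" using xy by (simp add: E_def)
    have P: "0 < P" using x y by (simp add: P_def upper_half_space_def)
    have "ennreal (LINT v:{0<..<1}|lborel. riesz_density lam b x y v)
      = (\<integral>\<^sup>+v. ennreal (riesz_density lam b x y v) * indicator {0<..<1} v \<partial>lborel)"
      using nn_integral_riesz_density[OF lam b0 x y xy] by simp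
    also have "\<dots> \<le> (\<integral>\<^sup>+v. ennreal (4 * 2 powr b) * (ennreal (v powr (lam - 1) * (E + (E + P) * v) powr (- b)) * indicator {0<..} v)
        + ennreal (2 * 2 powr b * (E + P) powr (- b)) * (ennreal (poisson_weight lam v) * indicator {0<..<1} v) \<partial>lborel)"
    proof (rule nn_integral_mono)
      fix v :: real
      show "ennreal (riesz_density lam b x y v) * indicator {0<..<1} v
        \<le> ennreal (4 * 2 powr b) * (ennreal (v powr (lam - 1) * (E + (E + P) * v) powr (- b)) * indicator {0<..} v)
        + ennreal (2 * 2 powr b * (E + P) powr (- b)) * (ennreal (poisson_weight lam v) * indicator {0<..<1} v)"
      proof (cases "v \<in> {0<..<1}")
        case True
        then have v: "0 < v" "v < 1" by auto
        have "riesz_density lam b x y v \<le> 2 * (poisson_weight lam v * (E + P * v) powr (- b))"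
          using riesz_density_le[OF lam b0 x y xy v] by (simp add: E_def P_def)
        also have "\<dots> \<le> 2 * (2 * 2 powr b * (v powr (lam - 1) * (E + (E + P) * v) powr (- b))
              + 2 powr b * (E + P) powr (- b) * poisson_weight lam v)"
          using poisson_weight_powr_le[OF lam b0 v E P] by simp
        also have "\<dots> = 4 * 2 powr b * (v powr (lam - 1) * (E + (E + P) * v) powr (- b))
              + 2 * 2 powr b * (E + P) powr (- b) * poisson_weight lam v"
          by (simp add: algebra_simps)
        finally have "ennreal (riesz_density lam b x y v)
          \<le> ennreal (4 * 2 powr b * (v powr (lam - 1) * (E + (E + P) * v) powr (- b))
              + 2 * 2 powr b * (E + P) powr (- b) * poisson_weight lam v)" by (rule ennreal_leI)
        also have "\<dots> = ennreal (4 * 2 powr b) * ennreal (v powr (lam - 1) * (E + (E + P) * v) powr (- b))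
          + ennreal (2 * 2 powr b * (E + P) powr (- b)) * ennreal (poisson_weight lam v)"
          by (simp only: ennreal_plus ennreal_mult'' mult_nonneg_nonneg powr_ge_zero poisson_weight_nonneg zero_le_numeral)
        finally show ?thesis using v by simp
      qed simp
    qed
    also have "\<dots> = ennreal (4 * 2 powr b) * ennreal (M * E powr (lam - b) * (E + P) powr (- lam))
        + ennreal (2 * 2 powr b * (E + P) powr (- b)) * ennreal B"
      using M(2)[OF E, of "E + P"] E P nn_integral_poisson_weight[OF lam]
      by (subst nn_integral_add, measurable, subst (1 2) nn_integral_cmult) (auto simp: B_def)
    also have "\<dots> = ennreal (4 * 2 powr b * (M * E powr (lam - b) * (E + P) powr (- lam))
        + 2 * 2 powr b * (E + P) powr (- b) * B)"
      by (simp only: ennreal_plus ennreal_mult'' mult_nonneg_nonneg powr_ge_zero zero_le_numeral M(1) less_imp_le[OF B])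
    finally have "(LINT v:{0<..<1}|lborel. riesz_density lam b x y v)
       \<le> 4 * 2 powr b * (M * E powr (lam - b) * (E + P) powr (- lam)) + 2 * 2 powr b * (E + P) powr (- b) * B"
      using M B by (subst (asm) ennreal_le_iff) (auto intro!: add_nonneg_nonneg mult_nonneg_nonneg)
    \<comment> \<open>The second term is absorbed by the first: \<lambda> < \<beta> gives (E +
      P)^(\<lambda>-\<beta>) \<le> E^(\<lambda>-\<beta>).\<close>
    also have "(E + P) powr (- b) \<le> E powr (lam - b) * (E + P) powr (- lam)"
    proof -
      have "(E + P) powr (- b) = (E + P) powr (lam - b) * (E + P) powr (- lam)"
        by (simp add: powr_add[symmetric])
      also have "\<dots> \<le> E powr (lam - b) * (E + P) powr (- lam)"
        using E P b by (intro mult_right_mono powr_mono2') auto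
      finally show ?thesis .
    qed
    also have "4 * 2 powr b * (M * E powr (lam - b) * (E + P) powr (- lam))
        + 2 * 2 powr b * (E powr (lam - b) * (E + P) powr (- lam)) * B
        = C * (E powr (lam - b) * (E + P) powr (- lam))"
      by (simp add: C_def algebra_simps)
    finally show ?thesis using B by (simp add: E_def P_def)
  qed
  with C show ?thesis by blast
qed

text \<open>The mean value theorem is applied to the ratio r = sqrt p / sqrt q, so that the error
  comes out relative to q^(-b). As \<delta> \<le> D/2 and D \<le> sqrt q, the ratio stays at least
  1/2, and the constant bounds the derivative of r^(-2b) on [1/2, \<infinity>).\<close>

lemma powr_sqrt_lipschitz:
  fixes b p q D \<delta> :: real
  assumes "0 < b" "0 < p" "0 < q" "\<bar>sqrt p - sqrt q\<bar> \<le> \<delta>" "\<delta> \<le> D / 2" "D \<le> sqrt q" "0 < D"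
  shows "\<bar>p powr (- b) - q powr (- b)\<bar> \<le> 2 * b * (1 / 2) powr (- 2 * b - 1) * (\<delta> / D) * q powr (- b)"
proof -
  define r where "r = sqrt p / sqrt q"
  have sq: "0 < sqrt q" using assms by simp
  have "1 - r = (sqrt q - sqrt p) / sqrt q" using sq by (simp add: r_def diff_divide_distrib)
  then have "\<bar>r - 1\<bar> = \<bar>sqrt p - sqrt q\<bar> / sqrt q"
    using sq by (simp add: abs_minus_commute)
  also have "\<dots> \<le> \<delta> / D"
    using assms by (intro frac_le) auto
  finally have r1: "\<bar>r - 1\<bar> \<le> \<delta> / D" .
  also have "\<delta> / D \<le> 1 / 2" using assms by (simp add: field_simps)
  finally have r2: "1 / 2 \<le> r" by linarith
  have "norm (r powr (- 2 * b) - 1 powr (- 2 * b)) \<le> 2 * b * (1 / 2) powr (- 2 * b - 1) * norm (r - 1)"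
  proof (rule field_differentiable_bound[of "{1/2..}"])
    fix z :: real assume z: "z \<in> {1/2..}"
    then show "((\<lambda>z. z powr (- 2 * b)) has_field_derivative (- 2 * b) * z powr (- 2 * b - 1)) (at z within {1/2..})"
      by (auto intro!: derivative_eq_intros)
    have "z powr (- 2 * b - 1) \<le> (1 / 2) powr (- 2 * b - 1)"
      using z assms by (intro powr_mono2') auto
    then show "norm ((- 2 * b) * z powr (- 2 * b - 1)) \<le> 2 * b * (1 / 2) powr (- 2 * b - 1)"
      using assms by (simp add: abs_mult)
  qed (use r2 in auto)
  also have "\<dots> \<le> 2 * b * (1 / 2) powr (- 2 * b - 1) * (\<delta> / D)"
    using assms r1 by (intro mult_left_mono) auto
  finally have A: "\<bar>r powr (- 2 * b) - 1\<bar> \<le> 2 * b * (1 / 2) powr (- 2 * b - 1) * (\<delta> / D)" by simp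
  have root: "u powr (- b) = sqrt u powr (- 2 * b)" if "0 < u" for u :: real
    using that by (simp add: powr_half_sqrt[symmetric] powr_powr)
  have "p powr (- b) = r powr (- 2 * b) * q powr (- b)"
    using assms by (simp only: root r_def powr_divide) simp
  then have "p powr (- b) - q powr (- b) = (r powr (- 2 * b) - 1) * q powr (- b)"
    by (simp add: left_diff_distrib)
  then have "\<bar>p powr (- b) - q powr (- b)\<bar> = \<bar>r powr (- 2 * b) - 1\<bar> * q powr (- b)"
    by (simp add: abs_mult)
  also have "\<dots> \<le> 2 * b * (1 / 2) powr (- 2 * b - 1) * (\<delta> / D) * q powr (- b)"
    using A by (intro mult_right_mono) auto
  finally show ?thesis .
qed

lemma riesz_integral_regular:
  fixes lam b :: real
  defines "L \<equiv> 2 * b * (1 / 2) powr (- 2 * b - 1)"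
  assumes lam: "0 < lam" and b: "0 < b" and x: "x \<in> upper_half_space" and x': "x' \<in> upper_half_space"
    and y: "y \<in> upper_half_space" and close: "dist x x' < dist x y / 2"
  shows "\<bar>(LINT v:{0<..<1}|lborel. riesz_density lam b x y v) - (LINT v:{0<..<1}|lborel. riesz_density lam b x' y v)\<bar>
    \<le> L * (dist x x' / dist x y) * (LINT v:{0<..<1}|lborel. riesz_density lam b x y v)"
proof -
  define k where "k = L * (dist x x' / dist x y)"
  have D: "0 < dist x y" using close zero_le_dist[of x x'] by linarith
  have "dist x y \<le> dist x x' + dist x' y" by (rule dist_triangle)
  then have D': "0 < dist x' y" using close D by linarith
  have xy: "x \<noteq> y" "x' \<noteq> y" using D D' by auto
  have int: "set_integrable lborel {0<..<1} (riesz_density lam b x y)"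
    "set_integrable lborel {0<..<1} (riesz_density lam b x' y)"
    using riesz_density_integrable lam b x x' y xy by blast+
  have pt: "\<bar>riesz_density lam b x' y v - riesz_density lam b x y v\<bar> \<le> k * riesz_density lam b x y v"
    if v: "0 < v" "v < 1" for v
  proof -
    have s: "\<bar>rot_dist_sq x' y s powr (- b) - rot_dist_sq x y s powr (- b)\<bar> \<le> k * rot_dist_sq x y s powr (- b)"
      if s: "\<bar>s\<bar> \<le> 1" for s
      unfolding k_def L_def
    proof (rule powr_sqrt_lipschitz[OF b])
      have s1: "s \<le> 1" using s by simp
      have le: "(dist x y)\<^sup>2 \<le> rot_dist_sq x y s" "(dist x' y)\<^sup>2 \<le> rot_dist_sq x' y s"
        by (intro dist_sq_le_rot_dist_sq x x' y s1)+
      moreover have "0 < (dist x y)\<^sup>2" "0 < (dist x' y)\<^sup>2" using D D' by auto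
      ultimately show "0 < rot_dist_sq x y s" "0 < rot_dist_sq x' y s" by linarith+
      show "dist x y \<le> sqrt (rot_dist_sq x y s)"
        using le(1) by (rule real_le_rsqrt)
      show "\<bar>sqrt (rot_dist_sq x' y s) - sqrt (rot_dist_sq x y s)\<bar> \<le> dist x x'"
        using sqrt_rot_dist_sq_lipschitz[OF s, of x y x'] by (simp add: abs_minus_commute)
    qed (use close D in auto)
    have ss: "\<bar>sqrt (1 - v)\<bar> \<le> 1" "\<bar>- sqrt (1 - v)\<bar> \<le> 1" using v by auto
    have "\<bar>(rot_dist_sq x' y (sqrt (1 - v)) powr (- b) + rot_dist_sq x' y (- sqrt (1 - v)) powr (- b))
        - (rot_dist_sq x y (sqrt (1 - v)) powr (- b) + rot_dist_sq x y (- sqrt (1 - v)) powr (- b))\<bar>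
      \<le> k * (rot_dist_sq x y (sqrt (1 - v)) powr (- b) + rot_dist_sq x y (- sqrt (1 - v)) powr (- b))"
      using s[OF ss(1)] s[OF ss(2)] unfolding distrib_left by linarith
    from mult_left_mono[OF this poisson_weight_nonneg[of lam v]] show ?thesis
      by (simp add: riesz_density_def right_diff_distrib[symmetric] abs_mult mult_ac)
  qed
  have "(LINT v:{0<..<1}|lborel. riesz_density lam b x' y v) \<le> (LINT v:{0<..<1}|lborel. (1 + k) * riesz_density lam b x y v)"
    using pt by (intro set_integral_mono int set_integrable_mult_right) (force simp: algebra_simps abs_le_iff)+
  moreover have "(LINT v:{0<..<1}|lborel. (1 - k) * riesz_density lam b x y v) \<le> (LINT v:{0<..<1}|lborel. riesz_density lam b x' y v)"
    using pt by (intro set_integral_mono int set_integrable_mult_right) (force simp: algebra_simps abs_le_iff)+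
  ultimately show ?thesis
    unfolding k_def[symmetric] set_integral_mult_right by (simp add: algebra_simps abs_le_iff)
qed

subsection \<open>Volume of balls\<close>

lemma upper_half_space_sets [measurable]:
  "(upper_half_space :: (real ^ 'm::{finite,linorder}) set) \<in> sets borel"
proof -
  have "(upper_half_space :: (real ^ 'm::{finite,linorder}) set) = last_coord -` {0<..} \<inter> space borel"
    by (auto simp: upper_half_space_def)
  also have "\<dots> \<in> sets borel" by (rule measurable_sets[OF last_coord_measurable]) auto
  finally show ?thesis .
qed

lemma space_bessel_measure [simp]: "space (bessel_measure lam) = upper_half_space"
  by (simp add: bessel_measure_def space_restrict_space)

lemma sets_bessel_measure: "sets (bessel_measure lam) = sets (restrict_space borel upper_half_space)"
  by (simp add: bessel_measure_def sets_restrict_space)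

lemma borel_measurable_bessel_measure:
  "f \<in> borel_measurable borel \<Longrightarrow> f \<in> borel_measurable (bessel_measure lam)"
  unfolding measurable_cong_sets[OF sets_bessel_measure refl] by (rule measurable_restrict_space1)

lemma id_measurable_bessel_measure: "(\<lambda>x. x) \<in> measurable (bessel_measure lam) borel"
  by (rule borel_measurable_bessel_measure) simp

lemma nn_integral_bessel_measure:
  fixes f :: "real ^ 'm::{finite,linorder} \<Rightarrow> ennreal"
  assumes [measurable]: "f \<in> borel_measurable borel"
  shows "(\<integral>\<^sup>+x. f x \<partial>bessel_measure lam)
    = (\<integral>\<^sup>+x. ennreal (last_coord x powr (2 * lam)) * f x * indicator upper_half_space x \<partial>lborel)"
proof -
  have "(\<integral>\<^sup>+x. f x \<partial>bessel_measure lam)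
    = (\<integral>\<^sup>+x. ennreal (last_coord x powr (2 * lam)) * f x \<partial>restrict_space lborel upper_half_space)"
    unfolding bessel_measure_def
    by (intro nn_integral_density measurable_restrict_space1) auto
  also have "\<dots> = (\<integral>\<^sup>+x. ennreal (last_coord x powr (2 * lam)) * f x * indicator upper_half_space x \<partial>lborel)"
    by (rule nn_integral_restrict_space) auto
  finally show ?thesis .
qed

lemma sigma_finite_bessel_measure:
  "sigma_finite_measure (bessel_measure lam :: (real ^ 'm::{finite,linorder}) measure)"
proof -
  have "sigma_finite_measure (restrict_space lborel (upper_half_space :: (real ^ 'm::{finite,linorder}) set))"
    by (intro sigma_finite_measure_restrict_space) (auto intro: sigma_finite_lborel)
  then show ?thesis
    unfolding bessel_measure_def
    by (subst sigma_finite_measure.sigma_finite_iff_density_finite)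
       (auto intro!: measurable_restrict_space1)
qed

lemma rel_ball_bessel_measure: "rel_ball (bessel_measure lam) x r = upper_half_space \<inter> ball x r"
  by (auto simp: rel_ball_def)

lemma last_coord_diff_le: "\<bar>last_coord x - last_coord y\<bar> \<le> dist x y"
  using dist_vec_nth_le[of x "Max UNIV" y] by (simp add: last_coord_def dist_real_def)

lemma last_coord_add_axis: "last_coord (x + axis (Max UNIV) t) = last_coord x + t"
  by (simp add: last_coord_def axis_def)

lemma dist_add_axis: "dist x (x + axis (Max UNIV) t) = \<bar>t\<bar>"
proof -
  have "(dist x (x + axis (Max UNIV) t))\<^sup>2 = t\<^sup>2"
    unfolding dist_sq_last_coord last_coord_add_axis by (simp add: axis_def)
  then have "(dist x (x + axis (Max UNIV) t))\<^sup>2 = \<bar>t\<bar>\<^sup>2" by simp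
  then show ?thesis by (rule power2_eq_imp_eq) auto
qed

lemma emeasure_bessel_ball:
  fixes x :: "real ^ 'm::{finite,linorder}"
  shows "emeasure (bessel_measure lam) (upper_half_space \<inter> ball x r)
    = (\<integral>\<^sup>+y. ennreal (last_coord y powr (2 * lam)) * indicator (upper_half_space \<inter> ball x r) y \<partial>lborel)"
proof -
  have [simp]: "upper_half_space \<inter> ball x r \<in> sets (bessel_measure lam)"
    unfolding sets_bessel_measure by (subst sets_restrict_space_iff) auto
  have "emeasure (bessel_measure lam) (upper_half_space \<inter> ball x r)
      = (\<integral>\<^sup>+y. indicator (upper_half_space \<inter> ball x r) y \<partial>bessel_measure lam)" by simp
  also have "\<dots> = (\<integral>\<^sup>+y. ennreal (last_coord y powr (2 * lam)) * indicator (upper_half_space \<inter> ball x r) y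
      * indicator upper_half_space y \<partial>lborel)"
    by (intro nn_integral_bessel_measure borel_measurable_indicator sets.Int upper_half_space_sets borel_open open_ball)
  also have "\<dots> = (\<integral>\<^sup>+y. ennreal (last_coord y powr (2 * lam)) * indicator (upper_half_space \<inter> ball x r) y \<partial>lborel)"
    by (intro nn_integral_cong) (auto simp: indicator_def)
  finally show ?thesis .
qed

text \<open>On the ball the last coordinate is at most a + r. The \<open>emeasure\<close> form also
  supplies the finiteness that local integrability requires.\<close>

lemma emeasure_bessel_ball_le:
  fixes x :: "real ^ 'm::{finite,linorder}" and lam r :: real
  assumes "0 < lam" and x: "x \<in> upper_half_space" and r: "0 < r"
  shows "emeasure (bessel_measure lam) (upper_half_space \<inter> ball x r)
    \<le> ennreal (unit_ball_vol (real CARD('m)) * (r ^ CARD('m) * (last_coord x + r) powr (2 * lam)))"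
proof -
  define a where "a = last_coord x"
  define W where "W = unit_ball_vol (real CARD('m))"
  have W: "0 \<le> W" by (simp add: W_def)
  have "emeasure (bessel_measure lam) (upper_half_space \<inter> ball x r)
    \<le> (\<integral>\<^sup>+y. ennreal ((a + r) powr (2 * lam)) * indicator (ball x r) y \<partial>lborel)"
    unfolding emeasure_bessel_ball
  proof (rule nn_integral_mono)
    fix y :: "real ^ 'm::{finite,linorder}"
    have "last_coord y powr (2 * lam) \<le> (a + r) powr (2 * lam)" if "y \<in> upper_half_space" "dist x y < r"
      using that assms last_coord_diff_le[of x y]
      by (intro powr_mono2) (auto simp: upper_half_space_def a_def)
    then show "ennreal (last_coord y powr (2 * lam)) * indicator (upper_half_space \<inter> ball x r) y
      \<le> ennreal ((a + r) powr (2 * lam)) * indicator (ball x r) y"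
      by (auto simp: indicator_def intro!: ennreal_leI)
  qed
  also have "\<dots> = ennreal ((a + r) powr (2 * lam)) * ennreal (W * r ^ CARD('m))"
    using r by (subst nn_integral_cmult_indicator) (auto simp: emeasure_ball W_def)
  also have "\<dots> = ennreal (W * (r ^ CARD('m) * (a + r) powr (2 * lam)))"
    using W r by (simp add: ennreal_mult[symmetric] mult_ac)
  finally show ?thesis by (simp only: a_def W_def)
qed

text \<open>The ball may be cut by the boundary, where the density tends to 0, so the lower bound is
  taken on a smaller ball pushed away from it.\<close>

lemma bessel_ball_vol_bounds:
  fixes x :: "real ^ 'm::{finite,linorder}" and lam r :: real
  defines "W \<equiv> unit_ball_vol (real CARD('m))"
  assumes "0 < lam" and x: "x \<in> upper_half_space" and r: "0 < r"
  shows "W * (1 / 4) ^ CARD('m) * (1 / 4) powr (2 * lam) * (r ^ CARD('m) * (last_coord x + r) powr (2 * lam))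
      \<le> ball_vol (bessel_measure lam) x r"
    and "ball_vol (bessel_measure lam) x r \<le> W * (r ^ CARD('m) * (last_coord x + r) powr (2 * lam))"
proof -
  define a where "a = last_coord x"
  define V where "V = emeasure (bessel_measure lam) (upper_half_space \<inter> ball x r)"
  have a: "0 < a" using x by (simp add: a_def upper_half_space_def)
  have W: "0 \<le> W" by (simp add: W_def)
  have vol: "emeasure lborel (ball z s) = ennreal (W * s ^ CARD('m))" if "0 \<le> s" for z :: "real ^ 'm::{finite,linorder}" and s
    using emeasure_ball[OF that, of z] by (simp add: W_def)
  have up: "V \<le> ennreal (W * (r ^ CARD('m) * (a + r) powr (2 * lam)))"
    unfolding V_def W_def a_def by (rule emeasure_bessel_ball_le) fact+
  \<comment> \<open>Shift upwards by r/2: the ball of radius r/4 about \<open>z\<close> stays within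
    3r/4 of \<open>x\<close>, and its last coordinates exceed a + r/4 \<ge> (a + r)/4. This is the
    origin of both factors 1/4.\<close>
  define z where "z = x + axis (Max UNIV) (r / 2)"
  have "ennreal (W * (1 / 4) ^ CARD('m) * (1 / 4) powr (2 * lam) * (r ^ CARD('m) * (a + r) powr (2 * lam)))
    = ennreal (((a + r) / 4) powr (2 * lam)) * ennreal (W * (r / 4) ^ CARD('m))"
    using a r W by (simp add: ennreal_mult[symmetric] powr_divide power_divide mult_ac)
  also have "\<dots> = (\<integral>\<^sup>+y. ennreal (((a + r) / 4) powr (2 * lam)) * indicator (ball z (r / 4)) y \<partial>lborel)"
    using r by (subst nn_integral_cmult_indicator) (auto simp: vol)
  also have "\<dots> \<le> V"
    unfolding V_def emeasure_bessel_ball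
  proof (rule nn_integral_mono)
    fix y :: "real ^ 'm::{finite,linorder}"
    have "((a + r) / 4) powr (2 * lam) \<le> last_coord y powr (2 * lam) \<and> y \<in> upper_half_space \<and> dist x y < r"
      if y: "dist z y < r / 4"
    proof -
      have "last_coord z = a + r / 2" by (simp add: z_def last_coord_add_axis a_def)
      moreover have "last_coord z - last_coord y \<le> dist z y"
        using last_coord_diff_le[of z y] by (simp add: abs_le_iff)
      ultimately have "a + r / 2 - last_coord y < r / 4" using y by simp
      then have "a + r \<le> 4 * last_coord y" using a by linarith
      then have "(a + r) / 4 \<le> last_coord y" by simp
      moreover have "dist x z = r / 2" using r by (simp add: z_def dist_add_axis)
      then have "dist x y < r" using dist_triangle[of x y z] y r by linarith
      ultimately show ?thesis
        using a r assms by (auto simp: upper_half_space_def intro!: powr_mono2)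
    qed
    then show "ennreal (((a + r) / 4) powr (2 * lam)) * indicator (ball z (r / 4)) y
      \<le> ennreal (last_coord y powr (2 * lam)) * indicator (upper_half_space \<inter> ball x r) y"
      by (auto simp: indicator_def intro!: ennreal_leI)
  qed
  finally have low: "ennreal (W * (1 / 4) ^ CARD('m) * (1 / 4) powr (2 * lam) * (r ^ CARD('m) * (a + r) powr (2 * lam))) \<le> V" .
  \<comment> \<open>\<open>measure\<close> is 0 on sets of infinite measure, so finiteness precedes
    the passage from \<open>emeasure\<close> to \<open>ball_vol\<close>.\<close>
  have "V \<noteq> top" using up by (auto simp: top_unique)
  then have V: "V = ennreal (ball_vol (bessel_measure lam) x r)"
    unfolding V_def ball_vol_def rel_ball_bessel_measure by (rule emeasure_eq_ennreal_measure)
  have V0: "0 \<le> ball_vol (bessel_measure lam) x r" by (simp add: ball_vol_def)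
  have U0: "0 \<le> W * (r ^ CARD('m) * (a + r) powr (2 * lam))" using W r by simp
  show "W * (1 / 4) ^ CARD('m) * (1 / 4) powr (2 * lam) * (r ^ CARD('m) * (last_coord x + r) powr (2 * lam))
      \<le> ball_vol (bessel_measure lam) x r"
    using low unfolding V ennreal_le_iff[OF V0] by (simp only: a_def)
  show "ball_vol (bessel_measure lam) x r \<le> W * (r ^ CARD('m) * (last_coord x + r) powr (2 * lam))"
    using up unfolding V ennreal_le_iff[OF U0] by (simp only: a_def)
qed

subsection \<open>Size and regularity of the kernel\<close>

lemma upper_half_space_add_axis:
  "x \<in> upper_half_space \<Longrightarrow> 0 \<le> t \<Longrightarrow> x + axis (Max UNIV) t \<in> upper_half_space"
  by (simp add: upper_half_space_def last_coord_add_axis)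

text \<open>D^2 + a c is comparable to (a + D)^2 because |a - c| \<le> D. From above, a c \<le> a (a
  + D). From below, D \<ge> (a + D)/3 if a \<le> 2 D; otherwise c \<ge> a/2 \<ge> (a + D)/3. The
  square of 3 is the constant 9. The new form matches the volume of the ball about
  \<open>x\<close>.\<close>

lemma riesz_size_compare:
  fixes x y :: "real ^ 'm::{finite,linorder}" and lam b :: real
  defines "E \<equiv> (dist x y)\<^sup>2" and "P \<equiv> last_coord x * last_coord y"
    and "R \<equiv> dist x y powr (2 * (lam - b)) * (last_coord x + dist x y) powr (- 2 * lam)"
  assumes lam: "0 < lam" and x: "x \<in> upper_half_space" and y: "y \<in> upper_half_space" and xy: "x \<noteq> y"
  shows "R \<le> E powr (lam - b) * (E + P) powr (- lam)"
    and "E powr (lam - b) * (E + P) powr (- lam) \<le> 9 powr lam * R"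
proof -
  define D a c where "D = dist x y" and "a = last_coord x" and "c = last_coord y"
  have D: "0 < D" using xy by (simp add: D_def)
  have ac: "0 < a" "0 < c" using x y by (auto simp: a_def c_def upper_half_space_def)
  have diff: "\<bar>a - c\<bar> \<le> D" unfolding a_def c_def D_def by (rule last_coord_diff_le)
  have EP: "E = D\<^sup>2" "P = a * c" by (simp_all add: E_def P_def D_def a_def c_def)
  have pos: "0 < E + P" using D ac by (simp add: EP add_pos_pos)
  have "a * c \<le> a * (a + D)" using diff ac by (intro mult_left_mono) auto
  moreover have "0 \<le> a * D" using ac D by simp
  ultimately have up: "E + P \<le> (a + D)\<^sup>2" by (simp add: EP power2_eq_square algebra_simps)
  have low: "((a + D) / 3)\<^sup>2 \<le> E + P"
  proof (cases "a \<le> 2 * D")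
    case True
    then have "((a + D) / 3)\<^sup>2 \<le> D\<^sup>2" using ac D by (intro power_mono) auto
    also have "\<dots> \<le> E + P" using ac by (simp add: EP)
    finally show ?thesis .
  next
    case False
    then have "a / 2 \<le> c" using diff by (simp add: abs_le_iff)
    moreover have "((a + D) / 3)\<^sup>2 \<le> (a / 2)\<^sup>2" using False ac D by (intro power_mono) auto
    moreover have "(a / 2)\<^sup>2 \<le> a * (a / 2)" by (simp add: power2_eq_square)
    ultimately have "((a + D) / 3)\<^sup>2 \<le> a * c" using ac mult_left_mono[of "a / 2" c a] by linarith
    also have "\<dots> \<le> E + P" by (simp add: EP)
    finally show ?thesis .
  qed
  have sq: "(u\<^sup>2) powr s = u powr (2 * s)" if "0 < u" for u s :: real
    using that powr_realpow[of u 2] by (simp add: powr_powr[symmetric])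
  have A: "E powr (lam - b) = D powr (2 * (lam - b))" using sq[OF D] by (simp add: EP)
  have pos2: "0 < a + D" using ac D by simp
  have B1: "(a + D) powr (- 2 * lam) \<le> (E + P) powr (- lam)"
    using powr_mono2'[of "- lam" "E + P" "(a + D)\<^sup>2"] up pos lam sq[OF pos2, of "- lam"] by simp
  have "(E + P) powr (- lam) \<le> (((a + D) / 3)\<^sup>2) powr (- lam)"
    using low pos2 lam by (intro powr_mono2') auto
  also have "\<dots> = 9 powr lam * (a + D) powr (- 2 * lam)"
  proof -
    have "((a + D) / 3)\<^sup>2 = (a + D)\<^sup>2 / 9" by (simp add: power_divide)
    then have "(((a + D) / 3)\<^sup>2) powr (- lam) = ((a + D)\<^sup>2) powr (- lam) / 9 powr (- lam)"
      by (simp only:) (simp add: powr_divide)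
    then show ?thesis using sq[OF pos2, of "- lam"] by (simp add: powr_minus_divide)
  qed
  finally have B2: "(E + P) powr (- lam) \<le> 9 powr lam * (a + D) powr (- 2 * lam)" .
  have R: "R = D powr (2 * (lam - b)) * (a + D) powr (- 2 * lam)" by (simp add: R_def D_def a_def)
  show "R \<le> E powr (lam - b) * (E + P) powr (- lam)"
    unfolding R A using B1 by (intro mult_left_mono) auto
  show "E powr (lam - b) * (E + P) powr (- lam) \<le> 9 powr lam * R"
    unfolding R A using mult_left_mono[OF B2, of "D powr (2 * (lam - b))"] by (simp add: mult_ac)
qed

lemma bessel_ball_vol_pos:
  assumes "0 < lam" "x \<in> upper_half_space" "0 < r"
  shows "0 < ball_vol (bessel_measure lam) x r"
proof -
  have "0 < last_coord x + r" using assms by (simp add: upper_half_space_def)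
  then have "0 < unit_ball_vol (real CARD('a)) * (1 / 4) ^ CARD('a) * (1 / 4) powr (2 * lam)
      * (r ^ CARD('a) * (last_coord x + r) powr (2 * lam))"
    using assms by (intro mult_pos_pos) auto
  also have "\<dots> \<le> ball_vol (bessel_measure lam) x r"
    by (rule bessel_ball_vol_bounds[OF assms])
  finally show ?thesis .
qed

lemma ball_vol_size_compare:
  fixes lam \<alpha> :: real
  assumes lam: "0 < lam"
  shows "\<exists>c>0. \<exists>C>0. \<forall>x\<in>upper_half_space. \<forall>r>0.
    c * (r powr \<alpha> / ball_vol (bessel_measure lam) (x :: real ^ 'm::{finite,linorder}) r)
       \<le> r powr (\<alpha> - real CARD('m)) * (last_coord x + r) powr (- 2 * lam)
    \<and> r powr (\<alpha> - real CARD('m)) * (last_coord x + r) powr (- 2 * lam)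
       \<le> C * (r powr \<alpha> / ball_vol (bessel_measure lam) x r)"
proof -
  define W where "W = unit_ball_vol (real CARD('m))"
  define w where "w = W * (1 / 4) ^ CARD('m) * (1 / 4) powr (2 * lam)"
  have W: "0 < W" by (simp add: W_def)
  then have w: "0 < w" by (simp add: w_def)
  have "w * (r powr \<alpha> / ball_vol (bessel_measure lam) x r)
       \<le> r powr (\<alpha> - real CARD('m)) * (last_coord x + r) powr (- 2 * lam)
    \<and> r powr (\<alpha> - real CARD('m)) * (last_coord x + r) powr (- 2 * lam)
       \<le> W * (r powr \<alpha> / ball_vol (bessel_measure lam) x r)"
    if x: "x \<in> upper_half_space" and r: "0 < r" for x :: "real ^ 'm::{finite,linorder}" and r
  proof -
    define V where "V = ball_vol (bessel_measure lam) x r"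
    define S where "S = r ^ CARD('m) * (last_coord x + r) powr (2 * lam)"
    have pos: "0 < last_coord x + r" using x r by (simp add: upper_half_space_def)
    have S: "0 < S" using pos r by (simp add: S_def)
    have V: "0 < V" unfolding V_def by (rule bessel_ball_vol_pos[OF lam x r])
    have b: "w * S \<le> V" "V \<le> W * S"
      using bessel_ball_vol_bounds[OF lam x r] by (simp_all add: w_def W_def S_def V_def)
    have eq: "r powr (\<alpha> - real CARD('m)) * (last_coord x + r) powr (- 2 * lam) = r powr \<alpha> / S"
      using r pos by (simp add: S_def powr_diff powr_realpow powr_minus_divide)
    have le: "w / V \<le> 1 / S" "1 / S \<le> W / V"
      using b S V by (simp_all add: field_simps)
    show ?thesis
      unfolding eq V_def[symmetric]
      using mult_left_mono[OF le(1), of "r powr \<alpha>"] mult_left_mono[OF le(2), of "r powr \<alpha>"]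
      by (simp add: mult_ac)
  qed
  then show ?thesis using W w by blast
qed

text \<open>Symmetry of the heat kernel; through it the regularity in the second variable reduces to
  that in the first.\<close>

lemma frac_bessel_kernel_commute: "frac_bessel_kernel lam \<alpha> x y = frac_bessel_kernel lam \<alpha> y x"
  unfolding frac_bessel_kernel_def bessel_heat_kernel_def
  by (simp add: power2_commute[of "x $ _"] mult.commute[of "last_coord x"] add.commute[of "(last_coord x)\<^sup>2"])

text \<open>The identity 2 (\<lambda> - \<beta>) = \<alpha> - N turns the bounds for the Poisson
  integral into the exponent in \<open>R\<close>. Regularity keeps \<open>K x y\<close> on the right
  until the kernel is compared with the volume.\<close>

theorem frac_bessel_kernel_estimates:
  fixes lam \<alpha> :: real
  assumes lam: "0 < lam" and \<alpha>: "0 < \<alpha>" "\<alpha> < real CARD('m::{finite,linorder})"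
  defines "K \<equiv> frac_bessel_kernel lam \<alpha> :: real ^ 'm::{finite,linorder} \<Rightarrow> real ^ 'm::{finite,linorder} \<Rightarrow> real"
    and "R \<equiv> \<lambda>x y :: real ^ 'm::{finite,linorder}.
       dist x y powr (\<alpha> - real CARD('m)) * (last_coord x + dist x y) powr (- 2 * lam)"
  shows "\<exists>c>0. \<exists>C>0. \<exists>L>0.
    (\<forall>x\<in>upper_half_space. \<forall>y\<in>upper_half_space. x \<noteq> y \<longrightarrow> c * R x y \<le> K x y \<and> K x y \<le> C * R x y) \<and>
    (\<forall>x\<in>upper_half_space. \<forall>x'\<in>upper_half_space. \<forall>y\<in>upper_half_space. dist x x' < dist x y / 2 \<longrightarrow>
       \<bar>K x y - K x' y\<bar> \<le> L * (dist x x' / dist x y) * K x y)"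
proof -
  define b where "b = real CARD('m) / 2 + lam - \<alpha> / 2"
  have b: "lam < b" "0 < b" using lam \<alpha> by (auto simp: b_def)
  define J where "J = (\<lambda>x y :: real ^ 'm::{finite,linorder}. LINT v:{0<..<1}|lborel. riesz_density lam b x y v)"
  obtain k where k: "0 < k" and K: "\<And>x y. x \<in> upper_half_space \<Longrightarrow> y \<in> upper_half_space \<Longrightarrow> x \<noteq> y \<Longrightarrow> K x y = k * J x y"
    using frac_bessel_kernel_eq_riesz_integral[where 'm = 'm, OF lam \<alpha>]
    unfolding K_def J_def b_def by blast
  obtain C where C: "0 < C" and J_up: "\<And>x y. x \<in> upper_half_space \<Longrightarrow> y \<in> upper_half_space \<Longrightarrow> x \<noteq> y \<Longrightarrow>
     J x y \<le> C * (((dist x y)\<^sup>2) powr (lam - b) * ((dist x y)\<^sup>2 + last_coord x * last_coord y) powr (- lam))"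
    using riesz_integral_upper[where 'a = 'm, OF lam b(1)] unfolding J_def by blast
  have R: "R x y = dist x y powr (2 * (lam - b)) * (last_coord x + dist x y) powr (- 2 * lam)" for x y
  proof -
    have "2 * (lam - b) = \<alpha> - real CARD('m)" by (simp add: b_def field_simps)
    then show ?thesis by (simp only: R_def)
  qed
  define c where "c = 3 powr (- b) / lam"
  have c: "0 < c" using lam by (simp add: c_def)
  define L where "L = 2 * b * (1 / 2) powr (- 2 * b - 1)"
  have L: "0 < L" using b by (simp add: L_def)
  have "k * c * R x y \<le> K x y \<and> K x y \<le> k * C * 9 powr lam * R x y"
    if xy: "x \<in> upper_half_space" "y \<in> upper_half_space" "x \<noteq> y" for x y
  proof -
    let ?S = "((dist x y)\<^sup>2) powr (lam - b) * ((dist x y)\<^sup>2 + last_coord x * last_coord y) powr (- lam)"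
    have S: "R x y \<le> ?S" "?S \<le> 9 powr lam * R x y"
      unfolding R by (rule riesz_size_compare[OF lam xy])+
    have "c * ?S \<le> J x y" unfolding J_def c_def by (rule riesz_integral_lower[OF lam b(2) xy])
    then have "c * R x y \<le> J x y" using mult_left_mono[OF S(1), of c] c by linarith
    moreover have "J x y \<le> C * (9 powr lam * R x y)"
      using J_up[OF xy] mult_left_mono[OF S(2), of C] C by linarith
    ultimately have "k * (c * R x y) \<le> k * J x y" "k * J x y \<le> k * (C * (9 powr lam * R x y))"
      using k by simp_all
    then show ?thesis unfolding K[OF xy] by (simp only: mult.assoc)
  qed
  moreover have "\<bar>K x y - K x' y\<bar> \<le> L * (dist x x' / dist x y) * K x y"
    if x: "x \<in> upper_half_space" and x': "x' \<in> upper_half_space" and y: "y \<in> upper_half_space"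
      and close: "dist x x' < dist x y / 2" for x x' y
  proof -
    have "x \<noteq> y" using close zero_le_dist[of x x'] by auto
    have "x' \<noteq> y" using close zero_le_dist[of x x'] by auto
    have "k * \<bar>J x y - J x' y\<bar> \<le> k * (L * (dist x x' / dist x y) * J x y)"
      using riesz_integral_regular[OF lam b(2) x x' y close] k
      unfolding J_def L_def by (intro mult_left_mono) auto
    moreover have "\<bar>k * J x y - k * J x' y\<bar> = k * \<bar>J x y - J x' y\<bar>"
      using k by (simp add: right_diff_distrib[symmetric] abs_mult)
    ultimately show ?thesis
      unfolding K[OF x y \<open>x \<noteq> y\<close>] K[OF x' y \<open>x' \<noteq> y\<close>] by (simp only: mult_ac)
  qed
  ultimately show ?thesis
    using k c C L by (intro exI[of _ "k * c"] exI[of _ "k * C * 9 powr lam"] exI[of _ L] conjI) auto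
qed

subsection \<open>Local integrability\<close>

lemma dyadic_shell_exists:
  fixes d R :: real
  assumes "0 < d" "d < R"
  shows "\<exists>k. R / 2 ^ Suc k \<le> d \<and> d < R / 2 ^ k"
proof -
  have "\<exists>j. (1 / 2) ^ j < d / R" using assms by (intro real_arch_pow_inv) auto
  then obtain j where "(1 / 2) ^ j < d / R" ..
  then have "R / 2 ^ j < d" using assms by (simp add: power_divide field_simps)
  moreover have "R / 2 ^ Suc j \<le> R / 2 ^ j" using assms by (simp add: field_simps)
  ultimately have ex: "R / 2 ^ Suc j \<le> d" by simp
  define k where "k = (LEAST j. R / 2 ^ Suc j \<le> d)"
  have k: "R / 2 ^ Suc k \<le> d" unfolding k_def using ex by (rule LeastI)
  have "d < R / 2 ^ k"
  proof (cases k)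
    case (Suc i)
    then have "i < (LEAST j. R / 2 ^ Suc j \<le> d)" by (simp add: k_def)
    then have "\<not> R / 2 ^ Suc i \<le> d" by (rule not_less_Least)
    then show ?thesis using Suc by simp
  qed (use assms in simp)
  with k show ?thesis by blast
qed

lemma ball_borel [measurable]: "ball (u :: 'a::euclidean_space) r \<in> sets borel"
  by simp

text \<open>Dyadic shells: where R/2^(k+1) \<le> |u - w| < R/2^k, the negative exponent bounds the
  power by \<open>c k\<close>, and the enclosing ball has measure W (R/2^k)^N. The products are
  geometric with ratio 2^(-\<alpha>), which is less than 1 because \<alpha> > 0. Ball volumes do not
  depend on the centre, so \<open>M\<close> is uniform in \<open>u\<close>.\<close>

lemma nn_integral_dist_powr_ball_bounded:
  fixes \<alpha> R :: real
  assumes \<alpha>: "0 < \<alpha>" "\<alpha> < real DIM('a::euclidean_space)" and R: "0 < R"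
  shows "\<exists>M\<ge>0. \<forall>u::'a. (\<integral>\<^sup>+w. ennreal (dist u w powr (\<alpha> - real DIM('a))) * indicator (ball u R) w \<partial>lborel) \<le> ennreal M"
proof -
  define N where "N = DIM('a)"
  define W where "W = unit_ball_vol (real N)"
  have W: "0 \<le> W" by (simp add: W_def)
  define c where "c = (\<lambda>k::nat. (R / 2 ^ Suc k) powr (\<alpha> - real N))"
  define g where "g = (\<lambda>k::nat. c k * (W * (R / 2 ^ k) ^ N))"
  have g0: "0 \<le> g k" for k using W R by (simp add: g_def c_def)
  have geq: "g k = (1 / 2) powr (\<alpha> - real N) * W * R powr \<alpha> * ((1 / 2) powr \<alpha>) ^ k" for k
  proof -
    have p: "0 < R / 2 ^ k" using R by simp
    have "R / 2 ^ Suc k = (R / 2 ^ k) * (1 / 2)" by simp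
    then have "c k = (R / 2 ^ k) powr (\<alpha> - real N) * (1 / 2) powr (\<alpha> - real N)"
      using p by (simp only: c_def powr_mult less_imp_le) 
    moreover have "(R / 2 ^ k) ^ N = (R / 2 ^ k) powr real N" using p by (simp add: powr_realpow)
    moreover have "(R / 2 ^ k) powr (\<alpha> - real N) * (R / 2 ^ k) powr real N = (R / 2 ^ k) powr \<alpha>"
      by (simp add: powr_add[symmetric])
    moreover have "(R / 2 ^ k) powr \<alpha> = R powr \<alpha> * ((1 / 2) powr \<alpha>) ^ k"
    proof -
      have "(R / 2 ^ k) = R * (1 / 2) powr real k" by (simp add: powr_realpow power_divide)
      then have "(R / 2 ^ k) powr \<alpha> = R powr \<alpha> * ((1 / 2) powr real k) powr \<alpha>"
        using R by (simp only: powr_mult) 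
      also have "((1 / 2) powr real k) powr \<alpha> = ((1 / 2 :: real) powr \<alpha>) powr real k"
        by (simp only: powr_powr mult.commute)
      also have "\<dots> = ((1 / 2) powr \<alpha>) ^ k" by (simp add: powr_realpow)
      finally show ?thesis .
    qed
    ultimately show ?thesis by (simp add: g_def mult_ac)
  qed
  have "(1 / 2 :: real) powr \<alpha> < 1" using \<alpha> powr_less_mono2[of \<alpha> "1 / 2" 1] by simp
  then have "summable (\<lambda>k. ((1 / 2 :: real) powr \<alpha>) ^ k)" by (intro summable_geometric) auto
  then have "summable g" unfolding geq by (intro summable_mult)
  have "(\<integral>\<^sup>+w. ennreal (dist u w powr (\<alpha> - real N)) * indicator (ball u R) w \<partial>lborel) \<le> ennreal (suminf g)" for u :: 'a
  proof -
    have "(\<integral>\<^sup>+w. ennreal (dist u w powr (\<alpha> - real N)) * indicator (ball u R) w \<partial>lborel)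
      \<le> (\<integral>\<^sup>+w. (\<Sum>k. ennreal (c k) * indicator (ball u (R / 2 ^ k)) w) \<partial>lborel)"
    proof (rule nn_integral_mono)
      fix w :: 'a
      define f where "f = (\<lambda>w k. ennreal (c k) * indicator (ball u (R / 2 ^ k)) w)"
      show "ennreal (dist u w powr (\<alpha> - real N)) * indicator (ball u R) w
        \<le> (\<Sum>k. ennreal (c k) * indicator (ball u (R / 2 ^ k)) w)"
      proof (cases "0 < dist u w \<and> dist u w < R")
        case True
        then obtain k where k: "R / 2 ^ Suc k \<le> dist u w" "dist u w < R / 2 ^ k"
          using dyadic_shell_exists by blast
        have "ennreal (dist u w powr (\<alpha> - real N)) * indicator (ball u R) w
            \<le> ennreal (c k) * indicator (ball u (R / 2 ^ k)) w"
          using k R \<alpha> True by (auto simp: c_def N_def intro!: ennreal_leI powr_mono2')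
        also have "\<dots> = f w k" by (simp only: f_def)
        also have "\<dots> = sum (f w) {k}" by simp
        also have "\<dots> \<le> suminf (f w)" by (rule sum_le_suminf) auto
        finally show ?thesis by (simp only: f_def)
      next
        case False
        \<comment> \<open>At the centre the integrand vanishes because \<open>0 powr x = 0\<close>;
          outside the ball the indicator vanishes.\<close>
        then have "ennreal (dist u w powr (\<alpha> - real N)) * indicator (ball u R) w = 0"
          by (auto simp: indicator_def)
        then show ?thesis by (simp only: zero_le)
      qed
    qed
    also have "\<dots> = (\<Sum>k. \<integral>\<^sup>+w. ennreal (c k) * indicator (ball u (R / 2 ^ k)) w \<partial>lborel)"
      by (rule nn_integral_suminf) measurable
    also have "\<dots> = (\<Sum>k. ennreal (g k))"
    proof (rule suminf_cong)
      fix k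
      have "(\<integral>\<^sup>+w. ennreal (c k) * indicator (ball u (R / 2 ^ k)) w \<partial>lborel)
          = ennreal (c k) * ennreal (W * (R / 2 ^ k) ^ N)"
        using R by (subst nn_integral_cmult_indicator) (auto simp: emeasure_ball W_def N_def)
      also have "\<dots> = ennreal (g k)" using W R by (simp add: g_def c_def ennreal_mult[symmetric])
      finally show "(\<integral>\<^sup>+w. ennreal (c k) * indicator (ball u (R / 2 ^ k)) w \<partial>lborel) = ennreal (g k)" .
    qed
    also have "\<dots> = ennreal (suminf g)" using g0 \<open>summable g\<close> by (rule suminf_ennreal2)
    finally show ?thesis .
  qed
  then show ?thesis
    using suminf_nonneg[OF \<open>summable g\<close>] g0 unfolding N_def by blast
qed

lemma frac_bessel_kernel_measurable:
  "(\<lambda>p. frac_bessel_kernel lam \<alpha> (fst p) (snd p :: real ^ 'm::{finite,linorder})) \<in> borel_measurable (borel \<Otimes>\<^sub>M borel)"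
proof -
  note borel_measurable_nth [measurable]
  have "(\<lambda>q. indicator {0<..} (snd q) *\<^sub>R
      (bessel_heat_kernel lam (snd q) (fst (fst q)) (snd (fst q) :: real ^ 'm::{finite,linorder}) / snd q powr (1 - \<alpha> / 2)))
     \<in> borel_measurable ((borel \<Otimes>\<^sub>M borel) \<Otimes>\<^sub>M lborel)"
    unfolding bessel_heat_kernel_def by measurable
  then show ?thesis
    unfolding frac_bessel_kernel_def set_lebesgue_integral_def
    by (intro borel_measurable_times borel_measurable_const lborel.borel_measurable_lebesgue_integral)
       (simp add: case_prod_beta')
qed

text \<open>For fixed \<open>u\<close>, the density at \<open>w\<close> is at most (a +
  D)^(2\<lambda>), with a the last coordinate of \<open>u\<close> and D = |u - w|, and this cancels
  the matching factor of the kernel bound. What remains is |u - w|^(\<alpha>-N) against Lebesgue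
  measure, bounded uniformly in \<open>u\<close>; the outer integral is then finite because
  \<open>A\<close> has finite measure.\<close>

lemma locally_integrable_frac_bessel_kernel:
  fixes lam \<alpha> :: real
  assumes lam: "0 < lam" and \<alpha>: "0 < \<alpha>" "\<alpha> < real CARD('m::{finite,linorder})"
  shows "locally_integrable_kernel (bessel_measure lam :: (real ^ 'm::{finite,linorder}) measure)
    (\<lambda>x y. complex_of_real (frac_bessel_kernel lam \<alpha> x y))"
  unfolding locally_integrable_kernel_def
proof (intro ballI allI impI)
  fix x y :: "real ^ 'm::{finite,linorder}" and r :: real
  let ?m = "bessel_measure lam :: (real ^ 'm::{finite,linorder}) measure"
  let ?K = "frac_bessel_kernel lam \<alpha> :: real ^ 'm::{finite,linorder} \<Rightarrow> _ \<Rightarrow> real"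
  assume "x \<in> space ?m" "y \<in> space ?m" and r: "0 < r"
  then have x: "x \<in> upper_half_space" and y: "y \<in> upper_half_space" by auto
  define A where "A = rel_ball ?m x r"
  define B where "B = rel_ball ?m y r"
  interpret m: sigma_finite_measure ?m by (rule sigma_finite_bessel_measure)
  have AB [measurable]: "A \<in> sets ?m" "B \<in> sets ?m"
    unfolding A_def B_def rel_ball_bessel_measure sets_bessel_measure
    by (subst sets_restrict_space_iff; auto)+
  have id: "(\<lambda>x. x) \<in> measurable ?m borel" by (rule id_measurable_bessel_measure)
  have [measurable]: "(\<lambda>p. ?K (fst p) (snd p)) \<in> borel_measurable (?m \<Otimes>\<^sub>M ?m)"
  proof -
    have "(\<lambda>p. (fst p, snd p)) \<in> measurable (?m \<Otimes>\<^sub>M ?m) (borel \<Otimes>\<^sub>M borel)"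
      by (intro measurable_Pair measurable_compose[OF measurable_fst id] measurable_compose[OF measurable_snd id])
    from measurable_compose[OF this frac_bessel_kernel_measurable] show ?thesis by simp
  qed
  \<comment> \<open>Large enough that the ball of radius \<open>R\<close> about any \<open>u\<close>
    in \<open>A\<close> contains \<open>B\<close>.\<close>
  define R where "R = 2 * r + dist x y"
  have R: "0 < R" using r by (simp add: R_def add_pos_nonneg)
  obtain M where M: "0 \<le> M" "\<forall>u :: real ^ 'm::{finite,linorder}. (\<integral>\<^sup>+w. ennreal (dist u w powr (\<alpha> - real CARD('m))) * indicator (ball u R) w \<partial>lborel) \<le> ennreal M"
    using nn_integral_dist_powr_ball_bounded[where 'a = "real ^ 'm::{finite,linorder}", of \<alpha> R] \<alpha> R by auto
  obtain C where C: "0 < C" and K: "\<And>u w. u \<in> upper_half_space \<Longrightarrow> w \<in> upper_half_space \<Longrightarrow> u \<noteq> w \<Longrightarrow>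
     0 \<le> ?K u w \<and> ?K u w \<le> C * (dist u w powr (\<alpha> - real CARD('m)) * (last_coord u + dist u w) powr (- 2 * lam))"
  proof -
    obtain c C where cC: "0 < c" "0 < C" and "\<forall>u\<in>upper_half_space. \<forall>w\<in>upper_half_space. u \<noteq> w \<longrightarrow>
       c * (dist u w powr (\<alpha> - real CARD('m)) * (last_coord u + dist u w) powr (- 2 * lam)) \<le> ?K u w \<and>
       ?K u w \<le> C * (dist u w powr (\<alpha> - real CARD('m)) * (last_coord u + dist u w) powr (- 2 * lam))"
      using frac_bessel_kernel_estimates[where 'm = 'm, OF lam \<alpha>] by blast
    moreover have "0 \<le> c * (dist u w powr (\<alpha> - real CARD('m)) * (last_coord u + dist u w) powr (- 2 * lam))" for u w
      using cC by simp
    ultimately show ?thesis using that by (meson order_trans)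
  qed
  have inner: "(\<integral>\<^sup>+w. ennreal \<bar>?K u w\<bar> * indicator B w \<partial>?m) \<le> ennreal (C * M)" if u: "u \<in> A" for u
  proof -
    have uH: "u \<in> upper_half_space" "dist x u < r" using u by (auto simp: A_def rel_ball_def)
    have [measurable]: "?K u \<in> borel_measurable borel"
      using measurable_compose[OF _ frac_bessel_kernel_measurable, of "\<lambda>w. (u, w)" borel lam \<alpha>] by simp
    have [measurable]: "upper_half_space \<inter> ball y r \<in> sets borel" by simp
    have "(\<integral>\<^sup>+w. ennreal \<bar>?K u w\<bar> * indicator B w \<partial>?m)
      = (\<integral>\<^sup>+w. ennreal (last_coord w powr (2 * lam)) * (ennreal \<bar>?K u w\<bar> * indicator B w) * indicator upper_half_space w \<partial>lborel)"
      unfolding B_def rel_ball_bessel_measure by (rule nn_integral_bessel_measure) measurable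
    also have "\<dots> \<le> (\<integral>\<^sup>+w. ennreal C * (ennreal (dist u w powr (\<alpha> - real CARD('m))) * indicator (ball u R) w) \<partial>lborel)"
    \<comment> \<open>The kernel bound holds only off the diagonal; the single point w = u is a null
      set.\<close>
    proof (rule nn_integral_mono_AE, rule eventually_mono[OF AE_lborel_singleton[of u]])
      fix w assume wu: "w \<noteq> u"
      show "ennreal (last_coord w powr (2 * lam)) * (ennreal \<bar>?K u w\<bar> * indicator B w) * indicator upper_half_space w
        \<le> ennreal C * (ennreal (dist u w powr (\<alpha> - real CARD('m))) * indicator (ball u R) w)"
      proof (cases "w \<in> B")
        case True
        then have w: "w \<in> upper_half_space" "dist y w < r" by (auto simp: B_def rel_ball_def)
        have "dist u w \<le> dist u x + (dist x y + dist y w)"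
          using dist_triangle[of u w x] dist_triangle[of x w y] by linarith
        then have uw: "dist u w < R" using uH w by (simp add: R_def dist_commute)
        define S where "S = last_coord u + dist u w"
        have S: "last_coord w \<le> S" "0 < last_coord w" "0 < S"
          using last_coord_diff_le[of w u] uH w
          by (auto simp: S_def upper_half_space_def dist_commute add_pos_nonneg)
        have "last_coord w powr (2 * lam) * \<bar>?K u w\<bar>
          \<le> S powr (2 * lam) * (C * (dist u w powr (\<alpha> - real CARD('m)) * S powr (- 2 * lam)))"
          using K[OF uH(1) w(1)] wu S lam unfolding S_def[symmetric]
          by (intro mult_mono powr_mono2) auto
        also have "\<dots> = C * dist u w powr (\<alpha> - real CARD('m))"
          using S by (simp add: powr_minus_divide)
        finally show ?thesis
          using True w uw C by (simp add: ennreal_mult''[symmetric] ennreal_leI)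
      qed simp
    qed
    also have "\<dots> = ennreal C * (\<integral>\<^sup>+w. ennreal (dist u w powr (\<alpha> - real CARD('m))) * indicator (ball u R) w \<partial>lborel)"
      by (rule nn_integral_cmult) measurable
    also have "\<dots> \<le> ennreal C * ennreal M" by (intro mult_left_mono M(2)[rule_format]) auto
    finally show ?thesis using C M by (simp add: ennreal_mult)
  qed
  have "(\<integral>\<^sup>+p. ennreal (norm (indicator (A \<times> B) p *\<^sub>R (case p of (u, w) \<Rightarrow> complex_of_real (?K u w)))) \<partial>(?m \<Otimes>\<^sub>M ?m))
    = (\<integral>\<^sup>+u. \<integral>\<^sup>+w. indicator A u * (ennreal \<bar>?K u w\<bar> * indicator B w) \<partial>?m \<partial>?m)"
  proof -
    have "(\<integral>\<^sup>+p. ennreal (norm (indicator (A \<times> B) p *\<^sub>R (case p of (u, w) \<Rightarrow> complex_of_real (?K u w)))) \<partial>(?m \<Otimes>\<^sub>M ?m))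
      = (\<integral>\<^sup>+p. indicator A (fst p) * (ennreal \<bar>?K (fst p) (snd p)\<bar> * indicator B (snd p)) \<partial>(?m \<Otimes>\<^sub>M ?m))"
      by (intro nn_integral_cong) (auto simp: indicator_def)
    also have "\<dots> = (\<integral>\<^sup>+u. \<integral>\<^sup>+w. indicator A u * (ennreal \<bar>?K u w\<bar> * indicator B w) \<partial>?m \<partial>?m)"
      by (subst m.nn_integral_fst[symmetric]) auto
    finally show ?thesis .
  qed
  also have "\<dots> \<le> (\<integral>\<^sup>+u. ennreal (C * M) * indicator A u \<partial>?m)"
    using inner by (intro nn_integral_mono) (auto simp: indicator_def)
  also have "\<dots> = ennreal (C * M) * emeasure ?m A"
    by (rule nn_integral_cmult_indicator) measurable
  also have "\<dots> < \<infinity>"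
  proof -
    have "emeasure ?m A \<le> ennreal (unit_ball_vol (real CARD('m)) * (r ^ CARD('m) * (last_coord x + r) powr (2 * lam)))"
      unfolding A_def rel_ball_bessel_measure by (rule emeasure_bessel_ball_le[OF lam x r])
    then have "emeasure ?m A < top" by (rule le_less_trans) simp
    then show ?thesis by (simp add: ennreal_mult_less_top)
  qed
  finally have fin: "(\<integral>\<^sup>+p. ennreal (norm (indicator (A \<times> B) p *\<^sub>R (case p of (u, w) \<Rightarrow> complex_of_real (?K u w)))) \<partial>(?m \<Otimes>\<^sub>M ?m)) < \<infinity>" .
  have "integrable (?m \<Otimes>\<^sub>M ?m) (\<lambda>p. indicator (A \<times> B) p *\<^sub>R (case p of (u, w) \<Rightarrow> complex_of_real (?K u w)))"
    by (rule integrableI_bounded[OF _ fin]) (unfold case_prod_beta', measurable)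
  then show "set_integrable (?m \<Otimes>\<^sub>M ?m) (rel_ball ?m x r \<times> rel_ball ?m y r) (\<lambda>(u, w). complex_of_real (?K u w))"
    by (simp add: set_integrable_def A_def B_def)
qed

subsection \<open>Non-degeneracy\<close>

theorem proposition12p5:
  fixes n :: nat and lam \<alpha> :: real
    and m :: "(real ^ 'm::{finite,linorder}) measure"
    and V K :: "real ^ 'm::{finite,linorder} \<Rightarrow> real ^ 'm::{finite,linorder} \<Rightarrow> real"
    and KC :: "real ^ 'm::{finite,linorder} \<Rightarrow> real ^ 'm::{finite,linorder} \<Rightarrow> complex"
    and \<phi> :: "real ^ 'm::{finite,linorder} \<Rightarrow> real \<Rightarrow> real"
  defines "m \<equiv> bessel_measure lam"
    and "V \<equiv> \<lambda>x y. ball_vol m x (dist x y)"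
    and "K \<equiv> frac_bessel_kernel lam \<alpha>"
    and "KC \<equiv> \<lambda>x y. complex_of_real (K x y)"
    and "\<phi> \<equiv> \<lambda>x r. r powr \<alpha>"
  assumes "CARD('m) = n + 1" and "lam > 0" and "0 < \<alpha>" and "\<alpha> < real n + 1"
  shows "(\<exists>c>0. \<exists>C>0. \<forall>x\<in>upper_half_space. \<forall>y\<in>upper_half_space. x \<noteq> y \<longrightarrow>
            c * (dist x y powr \<alpha> / V x y) \<le> K x y \<and> K x y \<le> C * (dist x y powr \<alpha> / V x y)) \<and>
         (\<exists>C>0. \<forall>x\<in>upper_half_space. \<forall>x'\<in>upper_half_space. \<forall>y\<in>upper_half_space.
            dist x x' < dist x y / 2 \<longrightarrow>
            \<bar>K x y - K x' y\<bar> + \<bar>K y x - K y x'\<bar>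
              \<le> C * (dist x y powr \<alpha> / V x y * (dist x x' / dist x y))) \<and>
         fractional_integral_operator m \<phi> (frac_bessel_operator lam \<alpha>) KC \<and>
         strongly_nondegenerate m \<phi> KC \<and>
         omega_regular m \<phi> (\<lambda>t. t) KC \<and>
         nondegenerate m \<phi> KC"
proof -
  have lam: "0 < lam" and \<alpha>: "0 < \<alpha>" "\<alpha> < real CARD('m)" using assms by auto
  \<comment> \<open>\<open>R\<close> stands between kernel and volume: \<open>c\<close> and
    \<open>C\<close> compare the kernel with \<open>R\<close>, while \<open>d\<close> and
    \<open>D\<close> compare \<open>R\<close> with the quotient of r^\<alpha> by the volume. The
    products c d and C D are the constants of the size estimate.\<close>
  define R where "R = (\<lambda>x y :: real ^ 'm::{finite,linorder}.
       dist x y powr (\<alpha> - real CARD('m)) * (last_coord x + dist x y) powr (- 2 * lam))"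
  have "\<exists>c>0. \<exists>C>0. \<exists>L>0.
    (\<forall>x\<in>upper_half_space. \<forall>y\<in>upper_half_space. x \<noteq> y \<longrightarrow> c * R x y \<le> K x y \<and> K x y \<le> C * R x y) \<and>
    (\<forall>x\<in>upper_half_space. \<forall>x'\<in>upper_half_space. \<forall>y\<in>upper_half_space. dist x x' < dist x y / 2 \<longrightarrow>
       \<bar>K x y - K x' y\<bar> \<le> L * (dist x x' / dist x y) * K x y)"
    unfolding K_def R_def by (rule frac_bessel_kernel_estimates[OF lam \<alpha>])
  then obtain c C L where c: "0 < c" and C: "0 < C" and L: "0 < L"
    and KR': "\<forall>x\<in>upper_half_space. \<forall>y\<in>upper_half_space. x \<noteq> y \<longrightarrow> c * R x y \<le> K x y \<and> K x y \<le> C * R x y"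
    and KL': "\<forall>x\<in>upper_half_space. \<forall>x'\<in>upper_half_space. \<forall>y\<in>upper_half_space. dist x x' < dist x y / 2 \<longrightarrow>
       \<bar>K x y - K x' y\<bar> \<le> L * (dist x x' / dist x y) * K x y"
    by (elim exE conjE)
  note KR = KR'[rule_format] and KL = KL'[rule_format]
  have "\<exists>d>0. \<exists>D>0. \<forall>x\<in>upper_half_space. \<forall>r>0.
    d * (r powr \<alpha> / ball_vol m x r) \<le> r powr (\<alpha> - real CARD('m)) * (last_coord x + r) powr (- 2 * lam) \<and>
    r powr (\<alpha> - real CARD('m)) * (last_coord x + r) powr (- 2 * lam) \<le> D * (r powr \<alpha> / ball_vol m x r)"
    unfolding m_def by (rule ball_vol_size_compare[OF lam])
  then obtain d D where d: "0 < d" and D: "0 < D" and RV': "\<forall>x\<in>upper_half_space. \<forall>r>0.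
    d * (r powr \<alpha> / ball_vol m x r) \<le> r powr (\<alpha> - real CARD('m)) * (last_coord x + r) powr (- 2 * lam) \<and>
    r powr (\<alpha> - real CARD('m)) * (last_coord x + r) powr (- 2 * lam) \<le> D * (r powr \<alpha> / ball_vol m x r)"
    by (elim exE conjE)
  have RV: "d * (r powr \<alpha> / ball_vol m x r) \<le> r powr (\<alpha> - real CARD('m)) * (last_coord x + r) powr (- 2 * lam)"
    "r powr (\<alpha> - real CARD('m)) * (last_coord x + r) powr (- 2 * lam) \<le> D * (r powr \<alpha> / ball_vol m x r)"
    if "x \<in> upper_half_space" "0 < r" for x r
    using RV' that by auto
  have Rpos: "0 < R x y" if "x \<in> upper_half_space" "x \<noteq> y" for x y
  proof -
    have "0 < last_coord x + dist x y" using that by (auto simp: upper_half_space_def intro: add_pos_nonneg)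
    then show ?thesis using that by (simp add: R_def)
  qed
  have sp: "space m = upper_half_space" by (simp add: m_def)
  have est: "(c * d) * (dist x y powr \<alpha> / V x y) \<le> K x y \<and> K x y \<le> (C * D) * (dist x y powr \<alpha> / V x y)"
    if "x \<in> upper_half_space" "y \<in> upper_half_space" "x \<noteq> y" for x y
  proof -
    have "d * (dist x y powr \<alpha> / V x y) \<le> R x y" "R x y \<le> D * (dist x y powr \<alpha> / V x y)"
      using RV[of x "dist x y"] that by (auto simp: R_def V_def)
    from mult_left_mono[OF this(1), of c] mult_left_mono[OF this(2), of C] KR[OF that] c C
    show ?thesis by (simp add: mult.assoc)
  qed
  have Kpos: "0 < K x y" if "x \<in> upper_half_space" "y \<in> upper_half_space" "x \<noteq> y" for x y
    using KR[OF that] mult_pos_pos[OF c Rpos[OF that(1,3)]] by linarith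
  have Kcomm: "K y x = K x y" for x y unfolding K_def by (rule frac_bessel_kernel_commute)
  \<comment> \<open>The factor 2 accounts for the second difference, which equals the first by
    symmetry.\<close>
  have reg: "\<bar>K x y - K x' y\<bar> + \<bar>K y x - K y x'\<bar>
      \<le> (2 * L * (C * D)) * (dist x y powr \<alpha> / V x y * (dist x x' / dist x y))"
    if x: "x \<in> upper_half_space" and x': "x' \<in> upper_half_space" and y: "y \<in> upper_half_space"
      and close: "dist x x' < dist x y / 2" for x x' y
  proof -
    have "x \<noteq> y" using close zero_le_dist[of x x'] by auto
    then have "K x y \<le> (C * D) * (dist x y powr \<alpha> / V x y)" using est x y by blast
    then have "L * (dist x x' / dist x y) * K x y \<le> L * (dist x x' / dist x y) * ((C * D) * (dist x y powr \<alpha> / V x y))"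
      using L by (intro mult_left_mono) auto
    from order_trans[OF KL[OF x x' y close] this]
    have "2 * \<bar>K x y - K x' y\<bar> \<le> 2 * (L * (dist x x' / dist x y) * ((C * D) * (dist x y powr \<alpha> / V x y)))"
      by (rule mult_left_mono) simp
    also have "\<dots> = (2 * L * (C * D)) * (dist x y powr \<alpha> / V x y * (dist x x' / dist x y))"
      by (simp only: mult_ac)
    finally show ?thesis unfolding Kcomm[of y x] Kcomm[of y x'] by simp
  qed
  have frac: "fractional_integral_operator m \<phi> (frac_bessel_operator lam \<alpha>) KC"
    unfolding fractional_integral_operator_def
  proof (intro conjI)
    show "\<forall>f. \<forall>x\<in>space m. frac_bessel_operator lam \<alpha> f x = (LINT y|m. KC x y * f y)"
      by (simp add: frac_bessel_operator_def m_def KC_def K_def)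
    show "locally_integrable_kernel m KC"
      unfolding m_def KC_def K_def by (rule locally_integrable_frac_bessel_kernel[OF lam \<alpha>])
    have "norm (KC x y) \<le> C * D * \<phi> x (dist x y) / ball_vol m x (dist x y)"
      if "x \<in> upper_half_space" "y \<in> upper_half_space" "x \<noteq> y" for x y
      using est[OF that] Kpos[OF that] by (simp add: KC_def \<phi>_def V_def)
    then show "\<exists>C>0. \<forall>x\<in>space m. \<forall>y\<in>space m. x \<noteq> y \<longrightarrow>
        norm (KC x y) \<le> C * \<phi> x (dist x y) / ball_vol m x (dist x y)"
      unfolding sp using C D by (intro exI[of _ "C * D"]) auto
  qed
  have omega: "omega_regular m \<phi> (\<lambda>t. t) KC"
    unfolding omega_regular_def sp
  proof (intro exI[of _ "2 * L * (C * D)"] conjI ballI impI)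
    show "0 < 2 * L * (C * D)" using L C D by simp
    fix x x' y :: "real ^ 'm::{finite,linorder}"
    assume "x \<in> upper_half_space" "x' \<in> upper_half_space" "y \<in> upper_half_space" "dist x x' < dist x y / 2"
    from reg[OF this]
    show "norm (KC x y - KC x' y) + norm (KC y x - KC y x')
          \<le> 2 * L * (C * D) * (dist x x' / dist x y) * (\<phi> x (dist x y) / ball_vol m x (dist x y))"
      unfolding KC_def of_real_diff[symmetric] norm_of_real \<phi>_def V_def by (simp only: mult_ac)
  qed
  have nondeg: "nondegenerate m \<phi> KC"
    unfolding nondegenerate_def sp
  proof (rule exI[of _ "c * d"], rule conjI[OF mult_pos_pos[OF c d]], rule exI[of _ 2], rule conjI,
      simp, intro ballI allI impI)
    fix x :: "real ^ 'm::{finite,linorder}" and r :: real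
    assume x: "x \<in> upper_half_space" and r: "0 < r"
    \<comment> \<open>At distance exactly \<open>r\<close>: outside the open ball of radius r,
      inside the one of radius 2 r. Moving upwards never leaves the half-space.\<close>
    define y where "y = x + axis (Max UNIV) r"
    have dist: "dist x y = r" using r by (simp add: y_def dist_add_axis)
    have y: "y \<in> upper_half_space" unfolding y_def using x r by (intro upper_half_space_add_axis) auto
    have "x \<noteq> y" using dist r by auto
    from est[OF x y this] Kpos[OF x y this] Kcomm[of x y]
    have "c * d * \<phi> x (dist x y) / ball_vol m x (dist x y) \<le> norm (KC x y) + norm (KC y x)"
      by (simp add: KC_def \<phi>_def V_def)
    moreover have "y \<in> rel_ball m x (2 * r) - rel_ball m x r"
      using y dist r by (auto simp: rel_ball_def sp)
    ultimately show "\<exists>y\<in>rel_ball m x (2 * r) - rel_ball m x r.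
        c * d * \<phi> x (dist x y) / ball_vol m x (dist x y) \<le> norm (KC x y) + norm (KC y x)" by blast
  qed
  have strong: "strongly_nondegenerate m \<phi> KC"
  proof -
    \<comment> \<open>If |x0 - y0| = 4 r, then points x, y of the balls of radius r about x0, y0
      satisfy 2 r < |x - y| < 6 r, and the last coordinate of x plus |x - y| is at most 7 times that
      of x0 plus r. These are the 6 and the 7.\<close>
    define q where "q = c * d * (6 powr (\<alpha> - real CARD('m)) * 7 powr (- 2 * lam))"
    have q: "0 < q" using c d by (simp add: q_def)
    have key: "q * \<phi> x0 r / ball_vol m x0 r \<le> norm (KC x y) \<and> \<bar>Arg (cnj 1 * KC x y)\<bar> \<le> 0"
      if x0: "x0 \<in> upper_half_space" and r: "0 < r" and y0: "dist x0 y0 = 4 * r"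
        and x: "x \<in> upper_half_space" "dist x0 x < r" and y: "y \<in> upper_half_space" "dist y0 y < r"
      for x0 y0 x y r
    proof -
      have "dist x0 y0 \<le> dist x0 x + (dist x y + dist y y0)"
        using dist_triangle[of x0 y0 x] dist_triangle[of x y0 y] by linarith
      then have lo: "2 * r < dist x y" using x y y0 by (simp add: dist_commute)
      have "dist x y \<le> dist x x0 + (dist x0 y0 + dist y0 y)"
        using dist_triangle[of x y x0] dist_triangle[of x0 y y0] by linarith
      then have hi: "dist x y < 6 * r" using x y y0 by (simp add: dist_commute)
      have xy: "x \<noteq> y" using lo r by auto
      have a0: "0 < last_coord x0" "0 < last_coord x" using x0 x by (auto simp: upper_half_space_def)
      have "last_coord x \<le> last_coord x0 + r"
        using last_coord_diff_le[of x0 x] x by (simp add: abs_le_iff)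
      then have S: "last_coord x + dist x y \<le> 7 * (last_coord x0 + r)" using hi a0 by simp
      \<comment> \<open>Both exponents are negative, so upper bounds for the bases bound the powers
        from below.\<close>
      have "(6 * r) powr (\<alpha> - real CARD('m)) \<le> dist x y powr (\<alpha> - real CARD('m))"
        using hi lo r \<alpha> by (intro powr_mono2') auto
      moreover have "(7 * (last_coord x0 + r)) powr (- 2 * lam) \<le> (last_coord x + dist x y) powr (- 2 * lam)"
        using S a0 r lam lo by (intro powr_mono2') (auto intro!: add_pos_nonneg)
      ultimately have "(6 * r) powr (\<alpha> - real CARD('m)) * (7 * (last_coord x0 + r)) powr (- 2 * lam) \<le> R x y"
        unfolding R_def by (intro mult_mono) auto
      moreover have "(6 * r) powr (\<alpha> - real CARD('m)) * (7 * (last_coord x0 + r)) powr (- 2 * lam)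
         = (6 powr (\<alpha> - real CARD('m)) * 7 powr (- 2 * lam))
            * (r powr (\<alpha> - real CARD('m)) * (last_coord x0 + r) powr (- 2 * lam))"
      proof -
        have "0 < last_coord x0 + r" using a0 r by simp
        then show ?thesis using r by (simp only: powr_mult mult_ac)
      qed
      ultimately have R1: "(6 powr (\<alpha> - real CARD('m)) * 7 powr (- 2 * lam))
            * (r powr (\<alpha> - real CARD('m)) * (last_coord x0 + r) powr (- 2 * lam)) \<le> R x y" by linarith
      have "(6 powr (\<alpha> - real CARD('m)) * 7 powr (- 2 * lam)) * (d * (r powr \<alpha> / ball_vol m x0 r))
         \<le> (6 powr (\<alpha> - real CARD('m)) * 7 powr (- 2 * lam))
            * (r powr (\<alpha> - real CARD('m)) * (last_coord x0 + r) powr (- 2 * lam))"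
        using RV(1)[OF x0 r] by (intro mult_left_mono) auto
      also have "\<dots> \<le> R x y" by (rule R1)
      finally have "c * ((6 powr (\<alpha> - real CARD('m)) * 7 powr (- 2 * lam)) * (d * (r powr \<alpha> / ball_vol m x0 r))) \<le> c * R x y"
        using c by (intro mult_left_mono) auto
      also have "\<dots> \<le> K x y" using KR[OF x(1) y(1) xy] by simp
      finally have "q * \<phi> x0 r / ball_vol m x0 r \<le> K x y"
        by (simp add: q_def \<phi>_def mult_ac)
      \<comment> \<open>A positive real has argument 0, which allows v = 1 and \<eta> = 0.\<close>
      then show ?thesis using Kpos[OF x(1) y(1) xy] by (simp add: KC_def Arg_of_real)
    qed
    have "\<exists>y0\<in>rel_ball m x0 (2 * 3 * r) - rel_ball m x0 (3 * r). \<exists>v. norm v = 1 \<and>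
            ((\<forall>x\<in>rel_ball m x0 r. \<forall>y\<in>rel_ball m y0 r.
                norm (KC x y) \<ge> q * \<phi> x0 r / ball_vol m x0 r \<and> \<bar>Arg (cnj v * KC x y)\<bar> \<le> 0) \<or>
             (\<forall>x\<in>rel_ball m x0 r. \<forall>y\<in>rel_ball m y0 r.
                norm (KC y x) \<ge> q * \<phi> x0 r / ball_vol m x0 r \<and> \<bar>Arg (cnj v * KC y x)\<bar> \<le> 0))"
      if x0: "x0 \<in> upper_half_space" and r: "0 < r" for x0 r
    proof -
      \<comment> \<open>Distance 4 r keeps the two balls of radius r apart and lies in [3 r, 6 r),
        which gives A = 3 and C = 2.\<close>
      define y0 where "y0 = x0 + axis (Max UNIV) (4 * r)"
      have dist: "dist x0 y0 = 4 * r" using r by (simp add: y0_def dist_add_axis)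
      have y0: "y0 \<in> upper_half_space" unfolding y0_def using x0 r by (intro upper_half_space_add_axis) auto
      have "y0 \<in> rel_ball m x0 (2 * 3 * r) - rel_ball m x0 (3 * r)"
        using y0 dist r by (auto simp: rel_ball_def sp)
      moreover have "\<forall>x\<in>rel_ball m x0 r. \<forall>y\<in>rel_ball m y0 r.
          norm (KC x y) \<ge> q * \<phi> x0 r / ball_vol m x0 r \<and> \<bar>Arg (cnj 1 * KC x y)\<bar> \<le> 0"
        using key[OF x0 r dist] by (simp add: rel_ball_def sp)
      moreover have "norm (1::complex) = 1" by simp
      ultimately show ?thesis by blast
    qed
    then have main: "\<forall>x0\<in>upper_half_space. \<forall>r>0.
        \<exists>y0\<in>rel_ball m x0 (2 * 3 * r) - rel_ball m x0 (3 * r). \<exists>v. norm v = 1 \<and>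
            ((\<forall>x\<in>rel_ball m x0 r. \<forall>y\<in>rel_ball m y0 r.
                norm (KC x y) \<ge> q * \<phi> x0 r / ball_vol m x0 r \<and> \<bar>Arg (cnj v * KC x y)\<bar> \<le> 0) \<or>
             (\<forall>x\<in>rel_ball m x0 r. \<forall>y\<in>rel_ball m y0 r.
                norm (KC y x) \<ge> q * \<phi> x0 r / ball_vol m x0 r \<and> \<bar>Arg (cnj v * KC y x)\<bar> \<le> 0))"
      by blast
    show ?thesis
      unfolding strongly_nondegenerate_def sp
    proof (rule exI[of _ 3], rule conjI, simp, rule exI[of _ q], rule conjI[OF q], rule exI[of _ 2], rule conjI,
        simp, rule bexI[of _ 0], rule main)
      show "(0::real) \<in> {0..pi / 9}" by simp
    qed
  qed
  have "\<exists>c>0. \<exists>C>0. \<forall>x\<in>upper_half_space. \<forall>y\<in>upper_half_space. x \<noteq> y \<longrightarrow>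
            c * (dist x y powr \<alpha> / V x y) \<le> K x y \<and> K x y \<le> C * (dist x y powr \<alpha> / V x y)"
    by (rule exI[of _ "c * d"], rule conjI[OF mult_pos_pos[OF c d]], rule exI[of _ "C * D"],
        rule conjI[OF mult_pos_pos[OF C D]]) (use est in blast)
  moreover have "\<exists>C>0. \<forall>x\<in>upper_half_space. \<forall>x'\<in>upper_half_space. \<forall>y\<in>upper_half_space.
            dist x x' < dist x y / 2 \<longrightarrow>
            \<bar>K x y - K x' y\<bar> + \<bar>K y x - K y x'\<bar>
              \<le> C * (dist x y powr \<alpha> / V x y * (dist x x' / dist x y))"
    using reg L C D by (intro exI[of _ "2 * L * (C * D)"] conjI) auto
  ultimately show ?thesis using frac omega nondeg strong by blast
qed

end
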